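(* Let $p\in\{0,1,\ldots,6\}$, let $\Omega\subseteq\mathbb{O}$ be a p-symmetric slice domain and let $f:\Omega\to\mathbb{O}$ be a (left) generalized partial-slice monogenic function of type $p$. Then, for any $\underline{\omega}\in\mathbb{S}$ and for $\boldsymbol{x}_p+r\underline{\omega}\in\Omega$ (with $\boldsymbol{x}_p\in\mathbb{R}^{p+1}$, $r\ge 0$), $$f(\boldsymbol{x}_p+r\underline{\omega})=\frac12\big(f(\boldsymbol{x}_p+r\underline{\eta})+f(\boldsymbol{x}_p-r\underline{\eta})\big)+\frac12\,\underline{\omega}\Big(\underline{\eta}\big(f(\boldsymbol{x}_p-r\underline{\eta})-f(\boldsymbol{x}_p+r\underline{\eta})\big)\Big)$$ for any $\underline{\eta}\in\mathbb{S}$. Moreover, the following two functions of $\boldsymbol{x}'=(\boldsymbol{x}_p,r)$ do not depend on $\underline{\eta}\in\mathbb{S}$: $$F_1(\boldsymbol{x}')=\frac12\big(f(\boldsymbol{x}_p+r\underline{\eta})+f(\boldsymbol{x}_p-r\underline{\eta})\big),\qquad F_2(\boldsymbol{x}')=\frac12\,\underline{\eta}\big(f(\boldsymbol{x}_p-r\underline{\eta})-f(\boldsymbol{x}_p+r\underline{\eta})\big).$$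
   Context: $\mathbb{O}$ is the real, non-associative, alternative algebra of octonions with basis $e_0=1,e_1,\ldots,e_7$ and product $e_ie_j=-\delta_{ij}+\sum_k\epsilon_{ijk}e_k$ for $1\le i,j\le 7$, where $\epsilon_{ijk}$ is totally antisymmetric, equals $1$ on the triples $(1,2,3),(1,4,5),(2,4,6),(3,4,7),(5,3,6),(6,1,7),(7,2,5)$, and vanishes on triples that are not permutations of these. $\mathbb{O}$ is identified with $\mathbb{R}^8$. A domain is a connected open set. Fix $p\in\{0,\ldots,6\}$ and $q=7-p$. Write $\boldsymbol{x}\in\mathbb{O}$ as $\boldsymbol{x}=\boldsymbol{x}_p+\underline{\boldsymbol{x}}_q$ with $\boldsymbol{x}_p=\sum_{i=0}^p x_ie_i\in\mathbb{R}^{p+1}$ and $\underline{\boldsymbol{x}}_q=\sum_{i=p+1}^7x_ie_i\in\mathbb{R}^q$. Let $\mathbb{S}=\{\sum_{i=p+1}^7x_ie_i:\sum_{i=p+1}^7x_i^2=1\}$. For $\Omega\subseteq\mathbb{O}$ open and $\underline{\omega}\in\mathbb{S}$ put $\Omega_{\underline{\omega}}=\Omega\cap(\mathbb{R}^{p+1}\oplus\underline{\omega}\mathbb{R})$, viewed as an open subset of $\mathbb{R}^{p+2}$ with coordinates $(x_0,\ldots,x_p,r)\leftrightarrow\boldsymbol{x}_p+r\underline{\omega}$. A function $f:\Omega\to\mathbb{O}$ on a domain $\Omega\subseteq\mathbb{O}$ is (left) generalized partial-slice monogenic of type $p$ if, for every $\underline{\omega}\in\mathbb{S}$, its restriction $f_{\underline{\omega}}$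 to $\Omega_{\underline{\omega}}$ is of class $C^1$ and satisfies $D_{\underline{\omega}}f_{\underline{\omega}}:=\sum_{i=0}^pe_i\,\partial_{x_i}f_{\underline{\omega}}+\underline{\omega}\,\partial_rf_{\underline{\omega}}=0$ on $\Omega_{\underline{\omega}}$. A domain $\Omega$ is a slice domain if $\Omega\cap\mathbb{R}^{p+1}\ne\emptyset$ and $\Omega_{\underline{\omega}}$ is a domain in $\mathbb{R}^{p+2}$ for every $\underline{\omega}\in\mathbb{S}$. It is p-symmetric (partially symmetric with respect to $\mathbb{R}^{p+1}$) if $\boldsymbol{x}_p+r\underline{\omega}\in\Omega$ with $\boldsymbol{x}_p\in\mathbb{R}^{p+1}$, $r>0$, $\underline{\omega}\in\mathbb{S}$ implies $\boldsymbol{x}_p+r\mathbb{S}\subseteq\Omega$. *)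

theory Defs
  imports "HOL-Analysis.Analysis"
begin

text \<open>
  Octonions are vectors in \<open>real ^ 8\<close>, which provides the norm and topology of \<open>\<real>\<^sup>8\<close>.
  The index type \<open>8\<close> is the ring of integers modulo 8, so its elements are the casts of the naturals
  \<open>0, \<dots>, 7\<close>. The instance \<open>(*)\<close> on \<open>real ^ 8\<close> is the componentwise product; the octonion
  product is \<open>\<odot>\<close> below.
\<close>

type_synonym octonion = "real ^ 8"

definition oct_e :: "nat \<Rightarrow> octonion" where
  "oct_e i = axis (of_nat i) 1"

definition oct_triples :: "(nat \<times> nat \<times> nat) set" where
  "oct_triples = {(1,2,3), (1,4,5), (2,4,6), (3,4,7), (5,3,6), (6,1,7), (7,2,5)}"

definition oct_eps :: "nat \<Rightarrow> nat \<Rightarrow> nat \<Rightarrow> real" where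
  "oct_eps i j k =
    (if (i,j,k) \<in> oct_triples \<or> (j,k,i) \<in> oct_triples \<or> (k,i,j) \<in> oct_triples then 1
     else if (j,i,k) \<in> oct_triples \<or> (i,k,j) \<in> oct_triples \<or> (k,j,i) \<in> oct_triples then - 1
     else 0)"

definition oct_basis_mult :: "nat \<Rightarrow> nat \<Rightarrow> octonion" where
  "oct_basis_mult i j =
    (if i = 0 then oct_e j
     else if j = 0 then oct_e i
     else (if i = j then - oct_e 0 else 0) + (\<Sum>k=1..7. oct_eps i j k *\<^sub>R oct_e k))"

definition oct_mult :: "octonion \<Rightarrow> octonion \<Rightarrow> octonion"  (infixl \<open>\<odot>\<close> 70) where
  "x \<odot> y = (\<Sum>i=0..7. \<Sum>j=0..7. (x $ of_nat i * y $ of_nat j) *\<^sub>R oct_basis_mult i j)"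

text \<open>The subspace \<open>\<real>\<^sup>p\<^sup>+\<^sup>1\<close> of the octonions and the unit sphere of the complementary \<open>\<real>\<^sup>q\<close>.\<close>

definition oct_para :: "nat \<Rightarrow> octonion set" where
  "oct_para p = {\<Sum>i=0..p. x i *\<^sub>R oct_e i | x :: nat \<Rightarrow> real. True}"

definition oct_sphere :: "nat \<Rightarrow> octonion set" where
  "oct_sphere p =
    {\<Sum>i=p+1..7. x i *\<^sub>R oct_e i | x :: nat \<Rightarrow> real. (\<Sum>i=p+1..7. (x i)\<^sup>2) = 1}"

definition slice_space :: "nat \<Rightarrow> octonion \<Rightarrow> octonion set" where
  "slice_space p \<omega> = {x + r *\<^sub>R \<omega> | x r. x \<in> oct_para p}"

definition slice_of :: "nat \<Rightarrow> octonion set \<Rightarrow> octonion \<Rightarrow> octonion set" where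
  "slice_of p \<Omega> \<omega> = \<Omega> \<inter> slice_space p \<omega>"

text \<open>
  Since \<open>1, e\<^sub>1, \<dots>, e\<^sub>p, \<omega>\<close> is an orthonormal basis of the slice space, the coordinates
  \<open>(x\<^sub>0, \<dots>, x\<^sub>p, r)\<close> identify it linearly and isometrically with \<open>\<real>\<^sup>p\<^sup>+\<^sup>2\<close>. Hence topological
  notions in \<open>\<real>\<^sup>p\<^sup>+\<^sup>2\<close> are those of the subspace topology, and the partial derivatives of a
  restriction \<open>f\<^sub>\<omega>\<close> with respect to \<open>x\<^sub>i\<close> and \<open>r\<close> are the derivatives along \<open>e\<^sub>i\<close> and \<open>\<omega>\<close>, which
  only involve values of \<open>f\<close> on the slice.
\<close>

definition has_partial :: "octonion \<Rightarrow> (octonion \<Rightarrow> octonion) \<Rightarrow> octonion \<Rightarrow> bool" where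
  "has_partial v f x \<longleftrightarrow> (\<lambda>t::real. f (x + t *\<^sub>R v)) differentiable (at 0)"

definition partial :: "octonion \<Rightarrow> (octonion \<Rightarrow> octonion) \<Rightarrow> octonion \<Rightarrow> octonion" where
  "partial v f x = vector_derivative (\<lambda>t::real. f (x + t *\<^sub>R v)) (at 0)"

definition slice_C1 :: "nat \<Rightarrow> octonion set \<Rightarrow> octonion \<Rightarrow> (octonion \<Rightarrow> octonion) \<Rightarrow> bool" where
  "slice_C1 p \<Omega> \<omega> f \<longleftrightarrow>
    (\<forall>v \<in> oct_e ` {0..p} \<union> {\<omega>}.
       (\<forall>x \<in> slice_of p \<Omega> \<omega>. has_partial v f x) \<and>
       continuous_on (slice_of p \<Omega> \<omega>) (partial v f))"

definition slice_D :: "nat \<Rightarrow> octonion \<Rightarrow> (octonion \<Rightarrow> octonion) \<Rightarrow> octonion \<Rightarrow> octonion" where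
  "slice_D p \<omega> f x = (\<Sum>i=0..p. oct_e i \<odot> partial (oct_e i) f x) + \<omega> \<odot> partial \<omega> f x"

definition gen_partial_slice_monogenic ::
    "nat \<Rightarrow> octonion set \<Rightarrow> (octonion \<Rightarrow> octonion) \<Rightarrow> bool" where
  "gen_partial_slice_monogenic p \<Omega> f \<longleftrightarrow>
    (\<forall>\<omega> \<in> oct_sphere p. slice_C1 p \<Omega> \<omega> f \<and> (\<forall>x \<in> slice_of p \<Omega> \<omega>. slice_D p \<omega> f x = 0))"

definition slice_domain :: "nat \<Rightarrow> octonion set \<Rightarrow> bool" where
  "slice_domain p \<Omega> \<longleftrightarrow>
    open \<Omega> \<and> connected \<Omega> \<and> \<Omega> \<inter> oct_para p \<noteq> {} \<and>
    (\<forall>\<omega> \<in> oct_sphere p.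
       openin (top_of_set (slice_space p \<omega>)) (slice_of p \<Omega> \<omega>) \<and> connected (slice_of p \<Omega> \<omega>))"

definition p_symmetric :: "nat \<Rightarrow> octonion set \<Rightarrow> bool" where
  "p_symmetric p \<Omega> \<longleftrightarrow>
    (\<forall>x \<in> oct_para p. \<forall>r > 0. \<forall>\<omega> \<in> oct_sphere p.
       x + r *\<^sub>R \<omega> \<in> \<Omega> \<longrightarrow> (\<forall>\<eta> \<in> oct_sphere p. x + r *\<^sub>R \<eta> \<in> \<Omega>))"

end

theory Submission
  imports Defs "HOL-Complex_Analysis.Conformal_Mappings"
begin

text \<open>
  For a fixed unit vector \<open>\<eta>\<close>, put \<open>F\<^sub>1 = (f(x + r\<eta>) + f(x - r\<eta>))/2\<close> and
  \<open>F\<^sub>2 = \<eta>(f(x - r\<eta>) - f(x + r\<eta>))/2\<close>. On the slice through another unit vector \<open>\<omega>\<close>, the function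
  \<open>F\<^sub>1 + \<omega>F\<^sub>2\<close> is again annihilated by \<open>D\<^sub>\<omega>\<close>: the equations \<open>D\<^sub>\<eta>f = 0\<close> at the two points \<open>x \<plusminus> r\<eta>\<close>
  are what is needed, because \<open>e\<^sub>i(\<omega>(\<eta>a)) = \<omega>(\<eta>(e\<^sub>ia))\<close> for \<open>i \<le> p\<close> and \<open>\<omega>(\<omega>a) = -a\<close>
  (\<open>splitting_remainder_monogenic\<close>). These two rules follow from the alternative law in the form
  \<open>x(ya) + y(xa) = -2\<langle>x,y\<rangle>a\<close> for imaginary \<open>x, y\<close>. The difference
  \<open>f - (F\<^sub>1 + \<omega>F\<^sub>2)\<close> is therefore monogenic on the slice and vanishes for \<open>r = 0\<close>. The formula follows once
  such a function is known to vanish identically, and the independence of \<open>\<eta>\<close> is then algebra.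

  The analytic core is this uniqueness statement for functions that are merely continuously differentiable
  along the coordinate axes. A function on a slice is first composed with the orthogonal projection of
  \<open>\<real>\<^sup>8\<close> onto the slice space. The result is annihilated by the full operator \<open>\<Sum>\<^sub>b b \<partial>\<^sub>b\<close>, where \<open>b\<close> runs through
  an orthonormal basis of \<open>\<real>\<^sup>8\<close>, so a single dimension serves every \<open>p\<close>. In dimension 8 the Cauchy kernel
  \<open>z\<^sup>c / |z|\<^sup>8\<close>, with \<open>z\<^sup>c\<close> the conjugate, is a rational function, which makes complexification easy.

  Regularise the kernel to \<open>z\<^sup>c / (|z|\<^sup>2 + \<epsilon>\<^sup>2)\<^sup>4\<close>, multiply by a cutoff that is constant on a ball, and integrate
  by parts (\<open>monogenic_cauchy_identity\<close>). This equates \<open>8 \<integral> \<epsilon>\<^sup>2 (|y - x|\<^sup>2 + \<epsilon>\<^sup>2)\<^sup>-\<^sup>5 h(y) dy\<close>, up to the cutoff,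
  with an integral over points \<open>y\<close> that stay away from \<open>x\<close>. As \<open>\<epsilon> \<rightarrow> 0\<close> the first integral tends to 0 if \<open>h\<close>
  vanishes near \<open>x\<close>, and does not tend to 0 if \<open>h(x) \<noteq> 0\<close>. The second integral converges to a function of \<open>x\<close>
  that extends holomorphically to a complex neighbourhood of each short segment, so if it vanishes on a small open
  set it vanishes on a ball of controlled radius. Hence \<open>h\<close> cannot vanish on an open set without vanishing on its whole
  connected domain (\<open>monogenic_unique_continuation\<close>).

  Finally, if \<open>h\<close> vanishes on the hyperplane \<open>r = 0\<close>, so do its tangential derivatives, and the equation
  then kills the normal derivative too. Replacing \<open>h\<close> by 0 on one side of the hyperplane thus gives
  another monogenic function (\<open>monogenic_zero_extension\<close>). It vanishes on an open set, hence everywhere.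
\<close>

section \<open>Octonion multiplication\<close>

lemma exhaust_8:
  fixes x :: 8
  shows "x = 0 \<or> x = 1 \<or> x = 2 \<or> x = 3 \<or> x = 4 \<or> x = 5 \<or> x = 6 \<or> x = 7"
proof (induct x)
  case (of_int z)
  then have "z = 0 \<or> z = 1 \<or> z = 2 \<or> z = 3 \<or> z = 4 \<or> z = 5 \<or> z = 6 \<or> z = 7" by auto
  then show ?case by auto
qed

lemma UNIV_8: "(UNIV :: 8 set) = {0, 1, 2, 3, 4, 5, 6, 7}"
  using exhaust_8 by auto

lemma sum_8: "sum g (UNIV :: 8 set) = g 0 + g 1 + g 2 + g 3 + g 4 + g 5 + g 6 + g 7"
  unfolding UNIV_8 by (simp add: ac_simps)

lemma forall_8: "(\<forall>i::8. P i) \<longleftrightarrow> P 0 \<and> P 1 \<and> P 2 \<and> P 3 \<and> P 4 \<and> P 5 \<and> P 6 \<and> P 7"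
  by (metis exhaust_8)

lemma Icc_0_7: "{0..7} = {0, 1, 2, 3, 4, 5, 6, 7::nat}" and Icc_1_7: "{1..7} = {1, 2, 3, 4, 5, 6, 7::nat}"
  by auto

text \<open>
  Computed once here, so that the coordinates of a general product can be read off by rewriting.
\<close>

lemma oct_basis_mult_table:
  "oct_basis_mult 1 1 = - oct_e 0" "oct_basis_mult 1 2 = oct_e 3" "oct_basis_mult 1 3 = - oct_e 2" "oct_basis_mult 1 4 = oct_e 5"
    "oct_basis_mult 1 5 = - oct_e 4" "oct_basis_mult 1 6 = - oct_e 7" "oct_basis_mult 1 7 = oct_e 6"
  "oct_basis_mult 2 1 = - oct_e 3" "oct_basis_mult 2 2 = - oct_e 0" "oct_basis_mult 2 3 = oct_e 1" "oct_basis_mult 2 4 = oct_e 6"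
    "oct_basis_mult 2 5 = oct_e 7" "oct_basis_mult 2 6 = - oct_e 4" "oct_basis_mult 2 7 = - oct_e 5"
  "oct_basis_mult 3 1 = oct_e 2" "oct_basis_mult 3 2 = - oct_e 1" "oct_basis_mult 3 3 = - oct_e 0" "oct_basis_mult 3 4 = oct_e 7"
    "oct_basis_mult 3 5 = - oct_e 6" "oct_basis_mult 3 6 = oct_e 5" "oct_basis_mult 3 7 = - oct_e 4"
  "oct_basis_mult 4 1 = - oct_e 5" "oct_basis_mult 4 2 = - oct_e 6" "oct_basis_mult 4 3 = - oct_e 7" "oct_basis_mult 4 4 = - oct_e 0"
    "oct_basis_mult 4 5 = oct_e 1" "oct_basis_mult 4 6 = oct_e 2" "oct_basis_mult 4 7 = oct_e 3"
  "oct_basis_mult 5 1 = oct_e 4" "oct_basis_mult 5 2 = - oct_e 7" "oct_basis_mult 5 3 = oct_e 6" "oct_basis_mult 5 4 = - oct_e 1"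
    "oct_basis_mult 5 5 = - oct_e 0" "oct_basis_mult 5 6 = - oct_e 3" "oct_basis_mult 5 7 = oct_e 2"
  "oct_basis_mult 6 1 = oct_e 7" "oct_basis_mult 6 2 = oct_e 4" "oct_basis_mult 6 3 = - oct_e 5" "oct_basis_mult 6 4 = - oct_e 2"
    "oct_basis_mult 6 5 = oct_e 3" "oct_basis_mult 6 6 = - oct_e 0" "oct_basis_mult 6 7 = - oct_e 1"
  "oct_basis_mult 7 1 = - oct_e 6" "oct_basis_mult 7 2 = oct_e 5" "oct_basis_mult 7 3 = oct_e 4" "oct_basis_mult 7 4 = - oct_e 3"
    "oct_basis_mult 7 5 = - oct_e 2" "oct_basis_mult 7 6 = oct_e 1" "oct_basis_mult 7 7 = - oct_e 0"
  by (simp_all add: oct_basis_mult_def Icc_1_7 oct_eps_def oct_triples_def del: One_nat_def)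

lemma oct_basis_mult_0: "oct_basis_mult 0 j = oct_e j" "oct_basis_mult i 0 = oct_e i"
  by (simp_all add: oct_basis_mult_def)

lemma oct_mult_components:
  "(x \<odot> y) $ 0 = x$0*y$0 - x$1*y$1 - x$2*y$2 - x$3*y$3 - x$4*y$4 - x$5*y$5 - x$6*y$6 - x$7*y$7"
  "(x \<odot> y) $ 1 = x$0*y$1 + x$1*y$0 + x$2*y$3 - x$3*y$2 + x$4*y$5 - x$5*y$4 - x$6*y$7 + x$7*y$6"
  "(x \<odot> y) $ 2 = x$0*y$2 - x$1*y$3 + x$2*y$0 + x$3*y$1 + x$4*y$6 + x$5*y$7 - x$6*y$4 - x$7*y$5"
  "(x \<odot> y) $ 3 = x$0*y$3 + x$1*y$2 - x$2*y$1 + x$3*y$0 + x$4*y$7 - x$5*y$6 + x$6*y$5 - x$7*y$4"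
  "(x \<odot> y) $ 4 = x$0*y$4 - x$1*y$5 - x$2*y$6 - x$3*y$7 + x$4*y$0 + x$5*y$1 + x$6*y$2 + x$7*y$3"
  "(x \<odot> y) $ 5 = x$0*y$5 + x$1*y$4 - x$2*y$7 + x$3*y$6 - x$4*y$1 + x$5*y$0 - x$6*y$3 + x$7*y$2"
  "(x \<odot> y) $ 6 = x$0*y$6 + x$1*y$7 + x$2*y$4 - x$3*y$5 - x$4*y$2 + x$5*y$3 + x$6*y$0 - x$7*y$1"
  "(x \<odot> y) $ 7 = x$0*y$7 - x$1*y$6 + x$2*y$5 + x$3*y$4 - x$4*y$3 - x$5*y$2 + x$6*y$1 + x$7*y$0"
  unfolding oct_mult_def Icc_0_7
  by (simp_all add: oct_basis_mult_table oct_basis_mult_0 oct_e_def axis_def del: One_nat_def)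

lemma bounded_bilinear_oct_mult: "bounded_bilinear (\<odot>)"
  unfolding bilinear_conv_bounded_bilinear [symmetric] bilinear_def
  by (auto intro!: linearI simp: vec_eq_iff forall_8 oct_mult_components algebra_simps)

interpretation oct_mult: bounded_bilinear "(\<odot>)"
  by (rule bounded_bilinear_oct_mult)

definition oct_cnj :: "octonion \<Rightarrow> octonion" where
  "oct_cnj x = (2 * x $ 0) *\<^sub>R oct_e 0 - x"

lemma oct_cnj_components:
  "oct_cnj x $ 0 = x $ 0" "i \<noteq> 0 \<Longrightarrow> oct_cnj x $ i = - x $ i"
  by (auto simp: oct_cnj_def oct_e_def axis_def)

lemma linear_oct_cnj: "linear oct_cnj"
  by (auto intro!: linearI simp: oct_cnj_def algebra_simps)

text \<open>
  Left multiplication by \<open>x\<close> is \<open>|x|\<close> times an isometry, and its transpose is left multiplication by the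
  conjugate. In the analysis below this identity stands in for associativity.
\<close>

lemma oct_cnj_mult_cancel: "oct_cnj x \<odot> (x \<odot> a) = (x \<bullet> x) *\<^sub>R a"
  by (simp add: vec_eq_iff forall_8 oct_mult_components oct_cnj_components inner_vec_def sum_8 algebra_simps)

text \<open>
  Polarisation of the previous identity: the Clifford relations for left multiplications.
\<close>

lemma oct_cnj_mult_polar:
  "oct_cnj x \<odot> (y \<odot> a) + oct_cnj y \<odot> (x \<odot> a) = (2 * (x \<bullet> y)) *\<^sub>R a"
  using oct_cnj_mult_cancel [of "x + y" a] 
  by (simp add: linear_add[OF linear_oct_cnj] oct_mult.add_left oct_mult.add_right inner_commute 
     oct_cnj_mult_cancel inner_add_left inner_add_right algebra_simps)

lemma oct_one_mult [simp]: "oct_e 0 \<odot> a = a"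
  by (simp add: vec_eq_iff forall_8 oct_mult_components oct_e_def axis_def)

lemma oct_imag_anticommute:
  assumes "x $ 0 = 0" "y $ 0 = 0"
  shows "x \<odot> (y \<odot> a) + y \<odot> (x \<odot> a) = - (2 * (x \<bullet> y)) *\<^sub>R a"
proof -
  have c: "oct_cnj x = - x" "oct_cnj y = - y"
    using assms by (simp_all add: oct_cnj_def)
  have "- (x \<odot> (y \<odot> a) + y \<odot> (x \<odot> a)) = (2 * (x \<bullet> y)) *\<^sub>R a"
    using oct_cnj_mult_polar [of x y a] by (simp add: c oct_mult.minus_left)
  then show ?thesis
    by (metis minus_equation_iff scaleR_minus_left)
qed

section \<open>Directional derivatives in Euclidean space\<close>

lemma has_vector_derivative_shift:
  fixes h :: "'a::real_vector \<Rightarrow> 'b::real_normed_vector"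
  assumes "((\<lambda>t. h ((y + s *\<^sub>R v) + t *\<^sub>R v)) has_vector_derivative D) (at 0)"
  shows "((\<lambda>t. h (y + t *\<^sub>R v)) has_vector_derivative D) (at s)"
proof -
  have "((\<lambda>t. t - s) has_vector_derivative 1) (at s)"
    by (auto intro!: derivative_eq_intros)
  moreover have "((\<lambda>t. h ((y + s *\<^sub>R v) + t *\<^sub>R v)) has_vector_derivative D) (at (s - s))"
    using assms by simp
  ultimately have "((\<lambda>t. h ((y + s *\<^sub>R v) + t *\<^sub>R v)) \<circ> (\<lambda>t. t - s) has_vector_derivative 1 *\<^sub>R D) (at s)"
    by (rule vector_diff_chain_at)
  then show ?thesis by (simp add: o_def algebra_simps)
qed

text \<open>
  Integration by parts without boundary terms. Instead of Fubini's theorem, the proof uses that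
  \<open>s \<mapsto> \<integral> u(y + sv) dy\<close> is constant by translation invariance and has derivative \<open>\<integral> \<partial>\<^sub>v u\<close> at 0.
\<close>

lemma integral_directional_derivative_eq_0:
  fixes u d :: "'a::euclidean_space \<Rightarrow> real"
  assumes der: "\<And>y. ((\<lambda>t. u (y + t *\<^sub>R v)) has_real_derivative d y) (at 0)"
    and contu: "continuous_on UNIV u" and contd: "continuous_on UNIV d"
    and supp: "\<And>y. y \<notin> cbox l r \<Longrightarrow> u y = 0"
  shows "integral (cbox l r) d = 0"
proof -
  have d0: "d y = 0" if "y \<notin> cbox l r" for y
  proof -
    have "open (- cbox l r)" by (rule open_Compl[OF closed_cbox])
    then have "eventually (\<lambda>z. z \<in> - cbox l r) (nhds (y + 0 *\<^sub>R v))"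
      using that by (intro eventually_nhds_in_open) auto
    moreover have "filterlim (\<lambda>t. y + t *\<^sub>R v) (nhds (y + 0 *\<^sub>R v)) (nhds (0::real))"
      by (intro tendsto_intros filterlim_ident)
    ultimately have "eventually (\<lambda>t. y + t *\<^sub>R v \<in> - cbox l r) (nhds 0)"
      by (rule eventually_compose_filterlim)
    then have "eventually (\<lambda>t. u (y + t *\<^sub>R v) = 0) (nhds 0)"
      by eventually_elim (use supp in auto)
    then have "((\<lambda>t. 0) has_real_derivative d y) (at 0)"
      using der[of y] DERIV_cong_ev[of 0 0 "\<lambda>t. u (y + t *\<^sub>R v)" "\<lambda>t. 0" "d y" "d y"] by simp
    then show ?thesis
      using DERIV_const DERIV_unique by blast
  qed
  \<comment> \<open>A box containing the supports of all translates of \<open>u\<close> that occur, so that Leibniz' rule applies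
    to integrals over one fixed domain.\<close>
  obtain a b where ab: "cbox (l - v) (r - v) \<union> cbox l r \<union> (\<lambda>(s, y). y - s *\<^sub>R v) ` ({0..1} \<times> cbox l r) \<subseteq> cbox a b"
  proof -
    have "compact ((\<lambda>(s, y). y - s *\<^sub>R v) ` ({0..1} \<times> cbox l r))"
      by (intro compact_continuous_image compact_Times)
         (auto simp: split_beta intro!: continuous_intros)
    then have "bounded (cbox (l - v) (r - v) \<union> cbox l r \<union> (\<lambda>(s, y). y - s *\<^sub>R v) ` ({0..1} \<times> cbox l r))"
      by (auto intro: compact_imp_bounded)
    then show ?thesis
      using bounded_subset_cbox_symmetric that by metis
  qed
  define F where "F s = integral (cbox a b) (\<lambda>y. u (y + s *\<^sub>R v))" for s
  have contus: "continuous_on S (\<lambda>y. u (y + s *\<^sub>R v))" for s S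
    by (rule continuous_on_compose2[OF contu]) (auto intro!: continuous_intros)
  have F_const: "F s = integral (cbox l r) u" if s: "s \<in> {0..1}" for s
  proof -
    have sub: "cbox (l - s *\<^sub>R v) (r - s *\<^sub>R v) \<subseteq> cbox a b"
    proof
      fix y assume "y \<in> cbox (l - s *\<^sub>R v) (r - s *\<^sub>R v)"
      then have "y + s *\<^sub>R v \<in> cbox l r"
        by (auto simp: mem_box inner_diff_left inner_add_left algebra_simps)
      then have "(s, y + s *\<^sub>R v) \<in> {0..1} \<times> cbox l r" using s by auto
      then have "(\<lambda>(s, y). y - s *\<^sub>R v) (s, y + s *\<^sub>R v) \<in> cbox a b" using ab by blast
      then show "y \<in> cbox a b" by simp
    qed
    have "F s = integral (cbox (l - s *\<^sub>R v) (r - s *\<^sub>R v)) (\<lambda>y. u (y + s *\<^sub>R v))"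
      unfolding F_def
    proof (rule integral_spike_set)
      have ne: "y \<in> cbox (l - s *\<^sub>R v) (r - s *\<^sub>R v)" if "u (y + s *\<^sub>R v) \<noteq> 0" for y
      proof -
        have "y + s *\<^sub>R v \<in> cbox l r" using supp that by blast
        then show ?thesis
          by (auto simp: mem_box inner_diff_left inner_add_left algebra_simps)
      qed
      show "negligible {x \<in> cbox a b - cbox (l - s *\<^sub>R v) (r - s *\<^sub>R v). u (x + s *\<^sub>R v) \<noteq> 0}"
        using ne by (auto intro: negligible_subset[OF negligible_empty])
      show "negligible {x \<in> cbox (l - s *\<^sub>R v) (r - s *\<^sub>R v) - cbox a b. u (x + s *\<^sub>R v) \<noteq> 0}"
        using sub by (auto intro: negligible_subset[OF negligible_empty])
    qed
    also have "\<dots> = integral (cbox l r) u"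
      using integral_shift_cbox_plus[of "l - s *\<^sub>R v" "r - s *\<^sub>R v" u "s *\<^sub>R v"]
      by (simp add: o_def add.commute)
    finally show ?thesis .
  qed
  have "(F has_field_derivative integral (cbox a b) (\<lambda>y. d (y + 0 *\<^sub>R v))) (at 0 within {0..1})"
    unfolding F_def
  proof (rule leibniz_rule_field_derivative)
    show "continuous_on ({0..1} \<times> cbox a b) (\<lambda>(s, y). d (y + s *\<^sub>R v))"
      unfolding split_beta
      by (rule continuous_on_compose2[OF contd]) (auto intro!: continuous_intros)
    show "((\<lambda>s. u (y + s *\<^sub>R v)) has_real_derivative d (y + s *\<^sub>R v)) (at s within {0..1})" for s y
      using has_vector_derivative_shift[of u y s v "d (y + s *\<^sub>R v)"] der[of "y + s *\<^sub>R v"]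
      by (simp add: has_real_derivative_iff_has_vector_derivative has_vector_derivative_at_within)
  qed (auto intro!: integrable_continuous contus)
  moreover have "(F has_field_derivative 0) (at 0 within {0..1})"
    using has_field_derivative_transform_within[of "\<lambda>_. integral (cbox l r) u" 0 0 "{0..1}" 1 F] F_const
    by simp
  ultimately have "integral (cbox a b) (\<lambda>y. d (y + 0 *\<^sub>R v)) = 0"
    unfolding has_field_derivative_iff at_within_Icc_at_right[OF zero_less_one]
    using tendsto_unique trivial_limit_at_right_real by blast
  then have "integral (cbox a b) d = 0" by simp
  moreover have "integral (cbox a b) d = integral (cbox l r) d"
    by (rule integral_spike_set) (use ab d0 in \<open>auto intro: negligible_subset[OF negligible_empty]\<close>)
  ultimately show ?thesis by simp
qed

definition orthonormal_frame :: "'a::euclidean_space set \<Rightarrow> bool" where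
  "orthonormal_frame B \<longleftrightarrow> finite B \<and> pairwise orthogonal B \<and> (\<forall>b\<in>B. norm b = 1) \<and> span B = UNIV"

lemma orthonormal_frame_expand:
  assumes "orthonormal_frame B"
  shows "(\<Sum>b\<in>B. (y \<bullet> b) *\<^sub>R b) = y"
  using assms by (intro orthonormal_basis_expand) (auto simp: orthonormal_frame_def)

lemma orthonormal_frame_card:
  fixes B :: "'a::euclidean_space set"
  assumes "orthonormal_frame B"
  shows "card B = DIM('a)"
proof -
  have "0 \<notin> B" using assms by (auto simp: orthonormal_frame_def)
  then have "independent B"
    using assms by (intro pairwise_orthogonal_independent) (auto simp: orthonormal_frame_def)
  then show ?thesis
    using assms by (metis dim_UNIV dim_eq_card_independent dim_span orthonormal_frame_def)
qed

lemma orthonormal_frame_inner: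
  assumes "orthonormal_frame B" "b \<in> B" "c \<in> B"
  shows "b \<bullet> c = (if b = c then 1 else 0)"
  using assms unfolding orthonormal_frame_def pairwise_def orthogonal_def
  by (metis norm_eq_1)

lemma norm_increment_le_along_line:
  fixes h :: "'a::real_vector \<Rightarrow> 'b::real_normed_vector"
  assumes der: "\<And>t. t \<in> closed_segment 0 c \<Longrightarrow> ((\<lambda>t. h (z + t *\<^sub>R v)) has_vector_derivative D t) (at t)"
    and bound: "\<And>t. t \<in> closed_segment 0 c \<Longrightarrow> norm (D t) \<le> M"
  shows "norm (h (z + c *\<^sub>R v) - h z) \<le> M * \<bar>c\<bar>"
proof -
  have "norm (h (z + c *\<^sub>R v) - h (z + 0 *\<^sub>R v)) \<le> M * norm (c - 0)"
  proof (rule differentiable_bound[where f = "\<lambda>t. h (z + t *\<^sub>R v)" and f' = "\<lambda>t s. s *\<^sub>R D t"])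
    fix t assume t: "t \<in> closed_segment 0 c"
    show "((\<lambda>t. h (z + t *\<^sub>R v)) has_derivative (\<lambda>s. s *\<^sub>R D t)) (at t within closed_segment 0 c)"
      using der[OF t] unfolding has_vector_derivative_def by (rule has_derivative_at_withinI)
    show "onorm (\<lambda>s. s *\<^sub>R D t) \<le> M"
      using bound[OF t] by (intro onorm_le) (simp add: mult.commute[of M] mult_left_mono)
  qed auto
  then show ?thesis by simp
qed

text \<open>
  Continuous partial derivatives are locally bounded, so the increments of \<open>h\<close> along the axes add
  up to a local Lipschitz estimate. Monogenic functions are given through partial derivatives along
  the axes, and this recovers their continuity.
\<close>

lemma continuous_on_if_C1_partials:
  fixes h :: "'a::euclidean_space \<Rightarrow> 'b::real_normed_vector"
  assumes B: "orthonormal_frame B" and U: "open U"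
    and der: "\<And>b y. b \<in> B \<Longrightarrow> y \<in> U \<Longrightarrow> ((\<lambda>t. h (y + t *\<^sub>R b)) has_vector_derivative d b y) (at 0)"
    and cont: "\<And>b. b \<in> B \<Longrightarrow> continuous_on U (d b)"
  shows "continuous_on U h"
proof (intro continuous_at_imp_continuous_on ballI)
  fix a assume a: "a \<in> U"
  have finB: "finite B" and normB: "\<And>b. b \<in> B \<Longrightarrow> norm b = 1" using B by (auto simp: orthonormal_frame_def)
  define M where "M = (\<Sum>b\<in>B. norm (d b a) + 1)"
  have "eventually (\<lambda>y. \<forall>b\<in>B. norm (d b y) < norm (d b a) + 1) (nhds a)"
  proof (intro eventually_ball_finite finB ballI)
    fix b assume "b \<in> B"
    then have "((\<lambda>y. norm (d b y)) \<longlongrightarrow> norm (d b a)) (at a)"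
      using cont U a by (intro tendsto_norm) (simp add: continuous_on_eq_continuous_at isCont_def)
    then have "eventually (\<lambda>y. norm (d b y) < norm (d b a) + 1) (at a)"
      by (rule order_tendstoD) simp
    then show "eventually (\<lambda>y. norm (d b y) < norm (d b a) + 1) (nhds a)"
      by (simp add: eventually_nhds_conv_at)
  qed
  moreover have "eventually (\<lambda>y. y \<in> U) (nhds a)" using U a by (rule eventually_nhds_in_open)
  ultimately have "eventually (\<lambda>y. y \<in> U \<and> (\<forall>b\<in>B. norm (d b y) < norm (d b a) + 1)) (nhds a)"
    by eventually_elim auto
  then obtain \<delta> where "\<delta> > 0" and \<delta>: "\<And>y. dist y a < \<delta> \<Longrightarrow> y \<in> U \<and> (\<forall>b\<in>B. norm (d b y) < norm (d b a) + 1)"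
    unfolding eventually_nhds_metric by blast
  have bound: "norm (d b y) \<le> M" if "b \<in> B" "dist y a < \<delta>" for b y
  proof -
    have "norm (d b y) \<le> norm (d b a) + 1" using \<delta> that by force
    also have "\<dots> \<le> M" unfolding M_def using that finB by (intro member_le_sum) auto
    finally show ?thesis .
  qed
  \<comment> \<open>Move from \<open>a\<close> one frame direction at a time; all intermediate points stay within \<open>\<delta>\<close> of \<open>a\<close>.\<close>
  have step: "norm (h (a + (\<Sum>b\<in>S. c b *\<^sub>R b)) - h a) \<le> M * (\<Sum>b\<in>S. \<bar>c b\<bar>)"
    if "finite S" "S \<subseteq> B" "(\<Sum>b\<in>S. \<bar>c b\<bar>) < \<delta>" for S c
    using that
  proof (induction S rule: finite_induct)
    case (insert b S)
    define z where "z = a + (\<Sum>b\<in>S. c b *\<^sub>R b)"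
    have normS: "norm (\<Sum>b\<in>S. c b *\<^sub>R b) \<le> (\<Sum>b\<in>S. \<bar>c b\<bar>)"
      using insert.prems normB by (intro sum_norm_le) auto
    then have z: "dist (z + t *\<^sub>R b) a < \<delta>" if "t \<in> closed_segment 0 (c b)" for t
    proof -
      have "\<bar>t\<bar> \<le> \<bar>c b\<bar>" using that by (auto simp: closed_segment_eq_real_ivl split: if_splits)
      have "dist (z + t *\<^sub>R b) a = norm ((\<Sum>b\<in>S. c b *\<^sub>R b) + t *\<^sub>R b)" by (simp add: z_def dist_norm)
      also have "\<dots> \<le> (\<Sum>b\<in>S. \<bar>c b\<bar>) + \<bar>c b\<bar>"
        using \<open>\<bar>t\<bar> \<le> \<bar>c b\<bar>\<close> normS insert.prems normB by (intro norm_triangle_mono) auto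
      also have "\<dots> < \<delta>" using insert.prems(2) insert.hyps by simp
      finally show ?thesis .
    qed
    have "norm (h (z + c b *\<^sub>R b) - h z) \<le> M * \<bar>c b\<bar>"
    proof (rule norm_increment_le_along_line[where h = h and D = "\<lambda>t. d b (z + t *\<^sub>R b)"])
      fix t assume t: "t \<in> closed_segment 0 (c b)"
      show "((\<lambda>t. h (z + t *\<^sub>R b)) has_vector_derivative d b (z + t *\<^sub>R b)) (at t)"
        by (rule has_vector_derivative_shift[where h = h], rule der) (use z[OF t] \<delta> insert.prems in auto)
      show "norm (d b (z + t *\<^sub>R b)) \<le> M"
        using bound[of b "z + t *\<^sub>R b"] z[OF t] insert.prems by auto
    qed
    moreover have "norm (h z - h a) \<le> M * (\<Sum>b\<in>S. \<bar>c b\<bar>)"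
      unfolding z_def using insert.hyps insert.prems by (intro insert.IH) auto
    ultimately have "norm (h (z + c b *\<^sub>R b) - h a) \<le> M * \<bar>c b\<bar> + M * (\<Sum>b\<in>S. \<bar>c b\<bar>)"
      using norm_triangle_mono[of "h (z + c b *\<^sub>R b) - h z" _ "h z - h a"] by simp
    then show ?case
      using insert.hyps by (simp add: z_def algebra_simps)
  qed auto
  have "M \<ge> 0" unfolding M_def by (intro sum_nonneg) auto
  have lip: "norm (h y - h a) \<le> M * (card B * norm (y - a))" if "card B * norm (y - a) < \<delta>" for y
  proof -
    have le: "(\<Sum>b\<in>B. \<bar>(y - a) \<bullet> b\<bar>) \<le> card B * norm (y - a)"
      using sum_bounded_above[of B "\<lambda>b. \<bar>(y - a) \<bullet> b\<bar>" "norm (y - a)"] normB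
      by (metis Cauchy_Schwarz_ineq2 mult.right_neutral)
    then have "norm (h (a + (\<Sum>b\<in>B. ((y - a) \<bullet> b) *\<^sub>R b)) - h a) \<le> M * (\<Sum>b\<in>B. \<bar>(y - a) \<bullet> b\<bar>)"
      using that by (intro step finB) auto
    also have "\<dots> \<le> M * (card B * norm (y - a))"
      using le \<open>M \<ge> 0\<close> by (rule mult_left_mono)
    finally show ?thesis by (simp add: orthonormal_frame_expand[OF B])
  qed
  have "((\<lambda>y. h y - h a) \<longlongrightarrow> 0) (at a)"
  proof (rule Lim_null_comparison)
    have "((\<lambda>y. card B * norm (y - a)) \<longlongrightarrow> card B * norm (a - a)) (at a)"
      by (intro tendsto_intros)
    then have "eventually (\<lambda>y. card B * norm (y - a) < \<delta>) (at a)"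
      by (rule order_tendstoD) (use \<open>\<delta> > 0\<close> in simp)
    then show "eventually (\<lambda>y. norm (h y - h a) \<le> M * (card B * norm (y - a))) (at a)"
      by eventually_elim (rule lip)
    have "((\<lambda>y. M * (card B * norm (y - a))) \<longlongrightarrow> M * (card B * norm (a - a))) (at a)"
      by (intro tendsto_intros)
    then show "((\<lambda>y. M * (card B * norm (y - a))) \<longlongrightarrow> 0) (at a)" by simp
  qed
  then show "isCont h a"
    using LIM_zero_cancel isCont_def by blast
qed

section \<open>Integrals against the Cauchy kernel and its divergence\<close>

text \<open>
  The kernels below have singularities, but they are multiplied by a function of \<open>y\<close> that vanishes near all of
  them. This glues the region \<open>K\<close> of regular points to the region \<open>L\<close> where the product is 0, jointly with
  a parameter \<open>p\<close> (the regularisation or the complexified position).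
\<close>

lemma continuous_on_Times_vanishing:
  fixes Q :: "'p::topological_space \<times> 'a::topological_space \<Rightarrow> 'c::real_normed_vector"
  assumes K: "closed K" and L: "closed L" and KL: "K \<union> L = UNIV"
    and vanish: "\<And>p y. p \<in> S \<Longrightarrow> y \<in> L \<Longrightarrow> Q (p, y) = 0"
    and cont: "continuous_on (S \<times> K) Q"
  shows "continuous_on (S \<times> C) Q"
proof -
  have "continuous_on (S \<times> K \<union> S \<times> L) Q"
  proof (rule continuous_on_Un_local)
    have "S \<times> K = (S \<times> K \<union> S \<times> L) \<inter> (UNIV \<times> K)" "S \<times> L = (S \<times> K \<union> S \<times> L) \<inter> (UNIV \<times> L)"
      using KL by auto
    then show "closedin (top_of_set (S \<times> K \<union> S \<times> L)) (S \<times> K)"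
      "closedin (top_of_set (S \<times> K \<union> S \<times> L)) (S \<times> L)"
      using K L by (metis closedin_closed closed_Times closed_UNIV)+
    show "continuous_on (S \<times> L) Q"
    proof (rule continuous_on_eq)
      show "continuous_on (S \<times> L) (\<lambda>_. 0)" by simp
    qed (use vanish in auto)
  qed (rule cont)
  then show ?thesis
    by (rule continuous_on_subset) (use KL in auto)
qed

text \<open>
  The function \<open>e\<^sup>2 / (|z|\<^sup>2 + e\<^sup>2)\<^sup>5\<close> is a multiple of the divergence of the regularised Cauchy kernel. Up to
  a constant factor it is an approximate identity on \<open>\<real>\<^sup>8\<close>; this lemma is its decay off the origin.
\<close>

lemma bubble_integral_tendsto_0:
  fixes k :: "octonion \<Rightarrow> real"
  assumes contk: "continuous_on UNIV k" and "d > 0" and k0: "\<And>y. y \<in> cball x d \<Longrightarrow> k y = 0"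
  shows "((\<lambda>e. integral (cbox l r) (\<lambda>y. e\<^sup>2 / ((y - x) \<bullet> (y - x) + e\<^sup>2) ^ 5 * k y)) \<longlongrightarrow> 0) (at 0)"
proof -
  let ?Q = "\<lambda>(e::real, y). e\<^sup>2 / ((y - x) \<bullet> (y - x) + e\<^sup>2) ^ 5 * k y"
  have "continuous_on (UNIV \<times> cbox l r) ?Q"
  proof (rule continuous_on_Times_vanishing[of "- ball x d" "cball x d"])
    have "y \<noteq> x" if "y \<in> - ball x d" for y using that \<open>d > 0\<close> by auto
    then have "(y - x) \<bullet> (y - x) + e\<^sup>2 \<noteq> 0" if "y \<in> - ball x d" for y and e :: real
      using that by (metis add_nonneg_eq_0_iff inner_eq_zero_iff inner_ge_zero right_minus_eq zero_le_power2)
    then show "continuous_on (UNIV \<times> - ball x d) ?Q"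
      unfolding split_beta
      by (intro continuous_intros continuous_on_compose2[OF contk]) auto
  qed (use k0 in auto)
  then have "continuous_on UNIV (\<lambda>e. integral (cbox l r) (\<lambda>y. e\<^sup>2 / ((y - x) \<bullet> (y - x) + e\<^sup>2) ^ 5 * k y))"
    by (intro integral_continuous_on_param) simp
  then have "isCont (\<lambda>e. integral (cbox l r) (\<lambda>y. e\<^sup>2 / ((y - x) \<bullet> (y - x) + e\<^sup>2) ^ 5 * k y)) 0"
    by (simp add: continuous_on_eq_continuous_at)
  then show ?thesis by (simp add: isCont_def)
qed

text \<open>
  The approximate identity carries mass bounded below on cubes of side proportional to \<open>e\<close>, by
  scaling, so a positive value of \<open>k\<close> at \<open>x\<close> is seen in the limit.
\<close>

lemma bubble_integral_not_tendsto_0: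
  fixes k :: "octonion \<Rightarrow> real"
  assumes contk: "continuous_on UNIV k" and pos: "k x > 0" and x: "x \<in> box l r"
  shows "\<not> ((\<lambda>e. integral (cbox l r) (\<lambda>y. e\<^sup>2 / ((y - x) \<bullet> (y - x) + e\<^sup>2) ^ 5 * k y)) \<longlongrightarrow> 0) (at 0)"
proof
  let ?P = "\<lambda>e y. e\<^sup>2 / ((y - x) \<bullet> (y - x) + e\<^sup>2) ^ 5"
  assume lim: "((\<lambda>e. integral (cbox l r) (\<lambda>y. ?P e y * k y)) \<longlongrightarrow> 0) (at 0)"
  have "open {y. k y > k x / 2}"
    by (rule open_Collect_less[OF continuous_on_const contk])
  then have "open ({y. k y > k x / 2} \<inter> box l r)" by (intro open_Int open_box)
  moreover have "x \<in> {y. k y > k x / 2} \<inter> box l r" using pos x by auto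
  ultimately obtain d where "d > 0" and d: "cball x d \<subseteq> {y. k y > k x / 2} \<inter> box l r"
    using open_contains_cball by metis
  \<comment> \<open>The negative part vanishes near \<open>x\<close> and contributes nothing in the limit; the positive part may be
    estimated from below on any subset.\<close>
  define k1 k2 where "k1 y = max 0 (k y)" and "k2 y = min 0 (k y)" for y
  have cont12: "continuous_on UNIV k1" "continuous_on UNIV k2"
    unfolding k1_def k2_def by (intro continuous_intros contk)+
  have "((\<lambda>e. integral (cbox l r) (\<lambda>y. ?P e y * k2 y)) \<longlongrightarrow> 0) (at 0)"
    using d pos \<open>d > 0\<close> by (intro bubble_integral_tendsto_0[where d = d] cont12) (force simp: k2_def)+
  with lim have lim1: "((\<lambda>e. integral (cbox l r) (\<lambda>y. ?P e y * k y) - integral (cbox l r) (\<lambda>y. ?P e y * k2 y)) \<longlongrightarrow> 0 - 0) (at 0)"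
    by (intro tendsto_diff)
  \<comment> \<open>On the cube of half-side \<open>e / 8\<close>, whose volume is \<open>(e / 4) ^ 8\<close>, the distance to \<open>x\<close> is at most \<open>e\<close>.
    The bubble is thus at least \<open>e\<^sup>2 / (2 * e\<^sup>2) ^ 5\<close> there, and \<open>k1\<close> is at least \<open>k x / 2\<close>.\<close>
  define m where "m = k x / 64 * (1 / 4) ^ 8"
  have low: "integral (cbox l r) (\<lambda>y. ?P e y * k y) - integral (cbox l r) (\<lambda>y. ?P e y * k2 y) \<ge> m"
    if e: "0 < e" "e < d" for e
  proof -
    have intg: "(\<lambda>y. ?P e y * g y) integrable_on cbox a b" if "continuous_on UNIV g" for g a b
    proof -
      have "(y - x) \<bullet> (y - x) + e\<^sup>2 \<noteq> 0" for y
        by (metis add_nonneg_eq_0_iff e(1) inner_ge_zero less_irrefl zero_eq_power2 zero_le_power2)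
      then show ?thesis
        by (intro integrable_continuous continuous_intros continuous_on_subset[OF that]) auto
    qed
    define c where "c = (\<Sum>b\<in>Basis. (e / 8) *\<^sub>R (b::octonion))"
    have c: "c \<bullet> b = e / 8" if "b \<in> Basis" for b
      using that by (simp add: c_def inner_sum_left_Basis)
    have near: "norm (y - x) \<le> e" if "y \<in> cbox (x - c) (x + c)" for y
    proof -
      have "norm (y - x) \<le> (\<Sum>b\<in>Basis. \<bar>(y - x) \<bullet> b\<bar>)" by (rule norm_le_l1)
      also have "\<dots> \<le> (\<Sum>b\<in>(Basis::octonion set). e / 8)"
      proof (rule sum_mono)
        fix b :: octonion assume b: "b \<in> Basis"
        then have "(x - c) \<bullet> b \<le> y \<bullet> b" "y \<bullet> b \<le> (x + c) \<bullet> b"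
          using that by (auto simp: mem_box)
        then show "\<bar>(y - x) \<bullet> b\<bar> \<le> e / 8"
          unfolding inner_diff_left inner_add_left c[OF b] by linarith
      qed
      also have "\<dots> = e" by simp
      finally show ?thesis .
    qed
    then have sub: "cbox (x - c) (x + c) \<subseteq> cball x d"
      using e by (force simp: dist_norm norm_minus_commute)
    have "m = integral (cbox (x - c) (x + c)) (\<lambda>y. e\<^sup>2 / (2 * e\<^sup>2) ^ 5 * (k x / 2))"
    proof -
      have "measure lborel (cbox (x - c) (x + c)) = (e / 4) ^ 8"
      proof -
        have "measure lborel (cbox (x - c) (x + c)) = (\<Prod>b\<in>(Basis::octonion set). e / 4)"
          using e by (subst content_cbox) (auto simp: inner_diff_left inner_add_left c intro!: prod.cong)
        then show ?thesis by simp
      qed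
      then show ?thesis
        using e by (simp add: m_def power_mult_distrib power_divide field_simps flip: power_add power_mult)
    qed
    also have "\<dots> \<le> integral (cbox (x - c) (x + c)) (\<lambda>y. ?P e y * k1 y)"
    proof (rule integral_le)
      fix y assume y: "y \<in> cbox (x - c) (x + c)"
      have "(y - x) \<bullet> (y - x) \<le> e\<^sup>2"
        using power_mono[OF near[OF y] norm_ge_zero, of 2] by (simp add: power2_norm_eq_inner)
      then have "((y - x) \<bullet> (y - x) + e\<^sup>2) ^ 5 \<le> (2 * e\<^sup>2) ^ 5"
        by (intro power_mono) auto
      moreover have "((y - x) \<bullet> (y - x) + e\<^sup>2) ^ 5 > 0"
        using e by (simp add: add_nonneg_pos)
      ultimately have "e\<^sup>2 / (2 * e\<^sup>2) ^ 5 \<le> ?P e y"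
        by (intro divide_left_mono) (use e in auto)
      moreover have "k x / 2 \<le> k1 y"
        using sub d y by (force simp: k1_def)
      ultimately show "e\<^sup>2 / (2 * e\<^sup>2) ^ 5 * (k x / 2) \<le> ?P e y * k1 y"
        using pos by (intro mult_mono) auto
    qed (intro intg cont12(1) integrable_const)+
    also have "\<dots> \<le> integral (cbox l r) (\<lambda>y. ?P e y * k1 y)"
      using sub d box_subset_cbox[of l r] by (intro integral_subset_le intg cont12) (auto simp: k1_def)
    also have "\<dots> = integral (cbox l r) (\<lambda>y. ?P e y * k y - ?P e y * k2 y)"
      by (rule integral_cong) (auto simp: k1_def k2_def max_def min_def)
    also have "\<dots> = integral (cbox l r) (\<lambda>y. ?P e y * k y) - integral (cbox l r) (\<lambda>y. ?P e y * k2 y)"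
      by (intro integral_diff intg contk cont12)
    finally show ?thesis .
  qed
  have "m \<le> 0 - 0"
  proof (rule tendsto_lowerbound)
    show "((\<lambda>e. integral (cbox l r) (\<lambda>y. ?P e y * k y) - integral (cbox l r) (\<lambda>y. ?P e y * k2 y)) \<longlongrightarrow> 0 - 0) (at_right 0)"
      using lim1 by (rule filterlim_at_split[THEN iffD1, THEN conjunct2])
    show "\<forall>\<^sub>F e in at_right 0. m \<le> integral (cbox l r) (\<lambda>y. ?P e y * k y) - integral (cbox l r) (\<lambda>y. ?P e y * k2 y)"
      using eventually_at_right_real[OF \<open>d > 0\<close>] by eventually_elim (use low in auto)
  qed simp
  moreover have "m > 0" using pos by (simp add: m_def zero_less_mult_iff)
  ultimately show False by simp
qed

text \<open>
  The component along \<open>c\<close> of the regularised Cauchy kernel \<open>z\<^sup>c / (|z|\<^sup>2 + e\<^sup>2)\<^sup>4\<close> at \<open>z = y - x\<close>, applied from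
  the left to \<open>k y\<close>. For \<open>e = 0\<close> this is the kernel \<open>z\<^sup>c / |z|\<^sup>8\<close>.
\<close>

definition cauchy_pairing :: "octonion \<Rightarrow> (octonion \<Rightarrow> octonion) \<Rightarrow> octonion \<Rightarrow> real \<Rightarrow> octonion \<Rightarrow> real" where
  "cauchy_pairing c k x e y = ((oct_cnj (y - x) \<odot> k y) \<bullet> c) / ((y - x) \<bullet> (y - x) + e\<^sup>2) ^ 4"

lemmas continuous_on_oct_mult [continuous_intros] = oct_mult.continuous_on

lemma continuous_on_oct_cnj [continuous_intros]:
  "continuous_on S g \<Longrightarrow> continuous_on S (\<lambda>x. oct_cnj (g x))"
  unfolding oct_cnj_def by (intro continuous_intros)

lemma cauchy_integral_tendsto:
  assumes contk: "continuous_on UNIV k" and k0: "\<And>y. y \<in> cball a R \<Longrightarrow> k y = 0" and x: "x \<in> ball a R"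
  shows "((\<lambda>e. integral (cbox l r) (cauchy_pairing c k x e)) \<longlongrightarrow> integral (cbox l r) (cauchy_pairing c k x 0)) (at 0)"
proof -
  let ?Q = "\<lambda>(e, y). cauchy_pairing c k x e y"
  have "continuous_on (UNIV \<times> cbox l r) ?Q"
  proof (rule continuous_on_Times_vanishing[of "- ball a R" "cball a R"])
    have "y \<noteq> x" if "y \<in> - ball a R" for y using that x by auto
    then have "(y - x) \<bullet> (y - x) + e\<^sup>2 \<noteq> 0" if "y \<in> - ball a R" for y and e :: real
      using that by (metis add_nonneg_eq_0_iff inner_eq_zero_iff inner_ge_zero right_minus_eq zero_le_power2)
    then show "continuous_on (UNIV \<times> - ball a R) ?Q"
      unfolding split_beta cauchy_pairing_def
      by (intro continuous_intros continuous_on_compose2[OF contk]) auto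
    show "?Q (e, y) = 0" if "y \<in> cball a R" for e y
      using k0[OF that] by (simp add: cauchy_pairing_def oct_mult.zero_right)
  qed auto
  then have "continuous_on UNIV (\<lambda>e. integral (cbox l r) (cauchy_pairing c k x e))"
    by (intro integral_continuous_on_param) simp
  then have "isCont (\<lambda>e. integral (cbox l r) (cauchy_pairing c k x e)) 0"
    by (simp add: continuous_on_eq_continuous_at)
  then show ?thesis by (simp add: isCont_def)
qed

text \<open>
  The left-hand side is the polynomial \<open>|w - tv|\<^sup>2\<close> continued to complex \<open>t\<close>; its real part is
  \<open>|w - (Re t)v|\<^sup>2 - (Im t)\<^sup>2 |v|\<^sup>2\<close>.
\<close>

lemma complexified_square_nonzero:
  fixes w v :: "'a::real_inner"
  assumes "norm (w - Re t *\<^sub>R v) > \<bar>Im t\<bar> * norm v"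
  shows "of_real (w \<bullet> w) - 2 * t * of_real (w \<bullet> v) + t\<^sup>2 * of_real (v \<bullet> v) \<noteq> 0"
proof -
  have "(\<bar>Im t\<bar> * norm v)\<^sup>2 < (norm (w - Re t *\<^sub>R v))\<^sup>2"
    by (rule power_strict_mono[OF assms]) auto
  then have "(Im t)\<^sup>2 * (v \<bullet> v) < (w - Re t *\<^sub>R v) \<bullet> (w - Re t *\<^sub>R v)"
    by (simp add: power_mult_distrib power2_norm_eq_inner)
  also have "\<dots> = w \<bullet> w - 2 * Re t * (w \<bullet> v) + (Re t)\<^sup>2 * (v \<bullet> v)"
    by (simp add: inner_diff_left inner_diff_right inner_commute power2_eq_square algebra_simps)
  finally have "Re (of_real (w \<bullet> w) - 2 * t * of_real (w \<bullet> v) + t\<^sup>2 * of_real (v \<bullet> v)) > 0"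
    by (simp add: power2_eq_square algebra_simps)
  then show ?thesis by force
qed

text \<open>
  On the line through \<open>x0\<close> and \<open>x1\<close> the integral is the restriction to the reals of a function that is
  holomorphic in a neighbourhood of the segment, since the integrand is a rational function of the
  position without poles there. It vanishes near \<open>x1\<close>, so it vanishes at \<open>x0\<close>.
\<close>

lemma cauchy_integral_unique_continuation:
  assumes contk: "continuous_on UNIV k" and k0: "\<And>y. y \<in> cball a R \<Longrightarrow> k y = 0"
    and W: "open W" and x1: "x1 \<in> W" "x1 \<in> ball a (R / 4)"
    and zero: "\<And>x. x \<in> W \<Longrightarrow> integral (cbox l r) (cauchy_pairing c k x 0) = 0"
    and x0: "x0 \<in> ball a (R / 4)"
  shows "integral (cbox l r) (cauchy_pairing c k x0 0) = 0"
proof -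
  define v where "v = x1 - x0"
  \<comment> \<open>The integrand at position \<open>x0 + t *\<^sub>R v\<close> has a numerator affine in \<open>t\<close> and the denominator \<open>q ^ 4\<close>.\<close>
  define \<alpha> \<beta> where "\<alpha> y = (oct_cnj (y - x0) \<odot> k y) \<bullet> c" and "\<beta> y = - (oct_cnj v \<odot> k y) \<bullet> c" for y
  define q where "q t y = of_real ((y - x0) \<bullet> (y - x0)) - 2 * t * of_real ((y - x0) \<bullet> v) + t\<^sup>2 * of_real (v \<bullet> v)"
    for t :: complex and y
  define g where "g t y = (of_real (\<alpha> y) + t * of_real (\<beta> y)) / q t y ^ 4" for t y
  define g' where "g' t y = (of_real (\<beta> y) * q t y - 4 * (of_real (\<alpha> y) + t * of_real (\<beta> y)) 
     * (2 * t * of_real (v \<bullet> v) - 2 * of_real ((y - x0) \<bullet> v))) / q t y ^ 5" for t y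
  \<comment> \<open>The strip has half-width 1: as \<open>norm v < R / 2\<close> and \<open>k\<close> lives outside \<open>ball a R\<close>, the denominator
    cannot vanish on it.\<close>
  define S where "S = {t. x0 + Re t *\<^sub>R v \<in> ball a (R / 4)} \<inter> {t. \<bar>Im t\<bar> < 1}"
  have "R > 0" using x0 by (metis divide_pos_pos dist_not_less_zero mem_ball not_less_iff_gr_or_eq order_less_trans zero_less_numeral zero_less_divide_iff)
  have \<alpha>\<beta>0: "\<alpha> y = 0" "\<beta> y = 0" if "y \<in> cball a R" for y
    using k0[OF that] by (simp_all add: \<alpha>_def \<beta>_def oct_mult.zero_right)
  have normv: "norm v < R / 2"
    using dist_triangle_less_add[of x1 a "R/4" x0 "R/4"] x0 x1(2) by (simp add: v_def dist_norm norm_minus_commute)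
  have q0: "q t y \<noteq> 0" if t: "t \<in> S" and y: "y \<in> - ball a R" for t y
    unfolding q_def
  proof (rule complexified_square_nonzero)
    have "\<bar>Im t\<bar> * norm v \<le> norm v"
      using t by (intro mult_left_le_one_le) (auto simp: S_def)
    also have "\<dots> < R - R / 4" using normv \<open>R > 0\<close> by simp
    also have "\<dots> < dist a y - dist a (x0 + Re t *\<^sub>R v)"
      using t y by (auto simp: S_def)
    also have "\<dots> \<le> dist y (x0 + Re t *\<^sub>R v)"
      using dist_triangle[of a y "x0 + Re t *\<^sub>R v"] by (simp add: dist_commute)
    finally show "\<bar>Im t\<bar> * norm v < norm (y - x0 - Re t *\<^sub>R v)"
      by (simp add: dist_norm algebra_simps)
  qed
  have cont: "continuous_on (S \<times> - ball a R) (\<lambda>p. q (fst p) (snd p))" "continuous_on UNIV \<alpha>" "continuous_on UNIV \<beta>"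
    unfolding q_def \<alpha>_def \<beta>_def by (intro continuous_intros contk)+
  have contg: "continuous_on (S \<times> cbox l r) (\<lambda>(t, y). g t y)"
    and contg': "continuous_on (S \<times> cbox l r) (\<lambda>(t, y). g' t y)"
    by (rule continuous_on_Times_vanishing[of "- ball a R" "cball a R"];
        force simp: g_def g'_def \<alpha>\<beta>0 split_beta q0 intro!: continuous_intros cont(1)
          continuous_on_compose2[OF cont(2)] continuous_on_compose2[OF cont(3)])+
  have "linear (\<lambda>t. Re t *\<^sub>R v)"
    by (rule linearI) (simp_all add: scaleR_left_distrib)
  moreover have "S = (\<lambda>t. Re t *\<^sub>R v) -` ball (a - x0) (R / 4) \<inter> Im -` {-1<..<1}"
    by (auto simp: S_def dist_norm algebra_simps abs_less_iff)
  ultimately have convS: "convex S"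
    by (auto intro!: convex_Int convex_linear_vimage bounded_linear.linear[OF bounded_linear_Im])
  have openS: "open S"
    unfolding S_def mem_ball by (intro open_Int open_Collect_less continuous_intros)
  have intg: "g t integrable_on cbox l r" if "t \<in> S" for t
  proof (rule integrable_continuous)
    have "continuous_on (cbox l r) (Pair t)" by (intro continuous_intros)
    then show "continuous_on (cbox l r) (g t)"
      using continuous_on_compose2[OF contg, of "cbox l r" "Pair t"] that by auto
  qed
  have hol: "(\<lambda>t. integral (cbox l r) (g t)) holomorphic_on S"
  proof (rule leibniz_rule_holomorphic[OF _ _ contg' convS])
    show "((\<lambda>t. g t y) has_field_derivative g' t y) (at t within S)" if "t \<in> S" for t y
    proof (cases "y \<in> cball a R")
      case True
      then show ?thesis by (simp add: g_def g'_def \<alpha>\<beta>0)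
    next
      case False
      then have "q t y \<noteq> 0" using q0 that by auto
      have "((\<lambda>t. q t y) has_field_derivative 2 * t * of_real (v \<bullet> v) - 2 * of_real ((y - x0) \<bullet> v)) (at t within S)"
        unfolding q_def by (auto intro!: derivative_eq_intros)
      from this \<open>q t y \<noteq> 0\<close> show ?thesis unfolding g_def g'_def
        by (auto intro!: derivative_eq_intros simp: divide_simps) (simp add: algebra_simps power_numeral_reduce)?
    qed
  qed (rule intg)
  have g_real: "integral (cbox l r) (g (of_real s)) = of_real (integral (cbox l r) (cauchy_pairing c k (x0 + s *\<^sub>R v) 0))"
    if s: "of_real s \<in> S" for s
  proof -
    have g_eq: "g (of_real s) y = of_real (cauchy_pairing c k (x0 + s *\<^sub>R v) 0 y)" for y
    proof -
      have "\<alpha> y + s * \<beta> y = (oct_cnj (y - (x0 + s *\<^sub>R v)) \<odot> k y) \<bullet> c"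
        by (simp add: \<alpha>_def \<beta>_def linear_diff[OF linear_oct_cnj] linear_add[OF linear_oct_cnj] linear_scale[OF linear_oct_cnj]
           oct_mult.diff_left oct_mult.add_left oct_mult.scaleR_left inner_diff_left inner_add_left algebra_simps)
      moreover have "(y - x0) \<bullet> (y - x0) - 2 * s * ((y - x0) \<bullet> v) + s\<^sup>2 * (v \<bullet> v) 
         = (y - (x0 + s *\<^sub>R v)) \<bullet> (y - (x0 + s *\<^sub>R v))"
        by (simp add: inner_diff_left inner_diff_right inner_add_left inner_add_right inner_commute power2_eq_square algebra_simps)
      moreover have "g (of_real s) y = of_real ((\<alpha> y + s * \<beta> y) 
        / ((y - x0) \<bullet> (y - x0) - 2 * s * ((y - x0) \<bullet> v) + s\<^sup>2 * (v \<bullet> v)) ^ 4)"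
        by (simp add: g_def q_def)
      ultimately show ?thesis
        unfolding cauchy_pairing_def
        by simp
    qed
    have "(\<lambda>y. Re (g (of_real s) y)) integrable_on cbox l r"
      using integrable_linear[OF intg[OF s] bounded_linear_Re] by (simp add: o_def)
    then have "cauchy_pairing c k (x0 + s *\<^sub>R v) 0 integrable_on cbox l r"
      unfolding g_eq by simp
    then have "((\<lambda>y. of_real (cauchy_pairing c k (x0 + s *\<^sub>R v) 0 y) :: complex) has_integral 
        of_real (integral (cbox l r) (cauchy_pairing c k (x0 + s *\<^sub>R v) 0))) (cbox l r)"
      by (intro has_integral_of_real integrable_integral)
    then show ?thesis
      unfolding g_eq[symmetric] by (rule integral_unique)
  qed
  have "integral (cbox l r) (g 0) = 0"
  proof (rule analytic_continuation[OF hol openS convex_connected[OF convS], where U = "of_real ` {s. x0 + s *\<^sub>R v \<in> W \<inter> ball a (R / 4)}" and \<xi> = 1])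
    show "0 \<in> S" "1 \<in> S" and sub: "of_real ` {s. x0 + s *\<^sub>R v \<in> W \<inter> ball a (R / 4)} \<subseteq> S"
      using x0 x1 by (auto simp: S_def v_def)
    have "open ((\<lambda>s. x0 + s *\<^sub>R v) -` (W \<inter> ball a (R / 4)))"
      using W by (intro open_vimage open_Int open_ball continuous_intros)
    then have "1 islimpt {s. x0 + s *\<^sub>R v \<in> W \<inter> ball a (R / 4)}"
      using x1 by (intro interior_limit_point) (simp add: vimage_def interior_open v_def)
    then show "1 islimpt complex_of_real ` {s. x0 + s *\<^sub>R v \<in> W \<inter> ball a (R / 4)}"
      using islimpt_isCont_image[of "1::real" _ complex_of_real] by (auto simp: eventually_at_filter)
    show "integral (cbox l r) (g t) = 0" if "t \<in> of_real ` {s. x0 + s *\<^sub>R v \<in> W \<inter> ball a (R / 4)}" for t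
      using that zero g_real sub by auto
  qed
  then show ?thesis using g_real[of 0] x0 by (simp add: S_def)
qed

section \<open>Monogenic functions and the Cauchy identity\<close>

text \<open>
  The directional derivatives \<open>d b\<close> are carried along explicitly, which makes it easy to extend a
  function and its derivatives together.
\<close>

definition monogenic_in_frame ::
  "octonion set \<Rightarrow> octonion set \<Rightarrow> (octonion \<Rightarrow> octonion) \<Rightarrow> (octonion \<Rightarrow> octonion \<Rightarrow> octonion) \<Rightarrow> bool" where
  "monogenic_in_frame B U h d \<longleftrightarrow>
    (\<forall>b\<in>B. \<forall>y\<in>U. ((\<lambda>t. h (y + t *\<^sub>R b)) has_vector_derivative d b y) (at 0)) \<and>
    (\<forall>b\<in>B. continuous_on U (d b)) \<and>
    (\<forall>y\<in>U. (\<Sum>b\<in>B. b \<odot> d b y) = 0)"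

text \<open>
  The building block of a cutoff function of class \<open>C\<^sup>1\<close>, which suffices for one integration by parts.
\<close>

lemma square_pos_part_has_derivative:
  "((\<lambda>s. (max 0 s)\<^sup>2) has_real_derivative 2 * max 0 s) (at s)"
proof -
  consider "s < 0" | "s = 0" | "s > 0" by linarith
  then show ?thesis
  proof cases
    case 1
    have "((\<lambda>s. 0::real) has_real_derivative 2 * max 0 s) (at s)" using 1 by simp
    then show ?thesis
      by (rule DERIV_cong_ev[THEN iffD1, rotated -1])
         (use 1 in \<open>auto simp: max_def intro: eventually_mono[OF eventually_nhds_in_open[of "{..<0}"]]\<close>)
  next
    case 2
    then show ?thesis
      by (auto simp: CARAT_DERIV power2_eq_square max_def intro!: exI[of _ "\<lambda>s. max 0 s"] continuous_intros)
  next
    case 3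
    have "((\<lambda>s. s\<^sup>2) has_real_derivative 2 * max 0 s) (at s)" using 3 by (auto intro!: derivative_eq_intros)
    then show ?thesis
      by (rule DERIV_cong_ev[THEN iffD1, rotated -1])
         (use 3 in \<open>auto simp: max_def intro: eventually_mono[OF eventually_nhds_in_open[of "{0<..}"]]\<close>)
  qed
qed

definition cutoff :: "real \<Rightarrow> real" where
  "cutoff s = (max 0 (1 - (max 0 (s - 1))\<^sup>2))\<^sup>2"

definition cutoff' :: "real \<Rightarrow> real" where
  "cutoff' s = 2 * max 0 (1 - (max 0 (s - 1))\<^sup>2) * (- (2 * max 0 (s - 1)))"

lemma cutoff_has_derivative [derivative_intros]:
  assumes "(g has_real_derivative g') (at x)"
  shows "((\<lambda>x. cutoff (g x)) has_real_derivative cutoff' (g x) * g') (at x)"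
proof -
  have "((\<lambda>s. 1 - (max 0 (s - 1))\<^sup>2) has_real_derivative - (2 * max 0 (s - 1))) (at s)" for s :: real
  proof -
    have "((\<lambda>s. s - 1) has_real_derivative 1) (at s)" by (auto intro!: derivative_eq_intros)
    from DERIV_diff[OF DERIV_const DERIV_chain2[OF square_pos_part_has_derivative this]]
    show ?thesis by simp
  qed
  from DERIV_chain2[OF square_pos_part_has_derivative this]
  have "(cutoff has_real_derivative cutoff' s) (at s)" for s
    unfolding cutoff_def[abs_def] cutoff'_def by simp
  from DERIV_chain2[OF this assms] show ?thesis .
qed

lemma continuous_cutoff [continuous_intros]:
  assumes "continuous_on S g"
  shows "continuous_on S (\<lambda>x. cutoff (g x))" "continuous_on S (\<lambda>x. cutoff' (g x))"
  unfolding cutoff_def cutoff'_def by (intro continuous_intros assms)+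

lemma cutoff_inside: "s \<le> 1 \<Longrightarrow> cutoff s = 1" "s \<le> 1 \<Longrightarrow> cutoff' s = 0"
  by (auto simp: cutoff_def cutoff'_def max_def)

lemma cutoff_outside: "s \<ge> 2 \<Longrightarrow> cutoff s = 0" "s \<ge> 2 \<Longrightarrow> cutoff' s = 0"
proof -
  assume "s \<ge> 2"
  then have "(max 0 (s - 1))\<^sup>2 \<ge> 1" by (intro one_le_power) auto
  then show "cutoff s = 0" "cutoff' s = 0" by (auto simp: cutoff_def cutoff'_def max_def)
qed
lemma continuous_on_UNIV_if_supported:
  fixes g :: "'a::topological_space \<Rightarrow> 'b::real_normed_vector"
  assumes "open U" "closed K" "K \<subseteq> U" "continuous_on U g" and 0: "\<And>y. y \<notin> K \<Longrightarrow> g y = 0"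
  shows "continuous_on UNIV g"
proof -
  have "continuous_on (- K) g"
    by (rule continuous_on_eq[of _ "\<lambda>_. 0"]) (auto simp: 0)
  then have "continuous_on (U \<union> - K) g"
    using assms by (intro continuous_on_open_Un) (auto simp: open_Compl)
  moreover have "U \<union> - K = UNIV" using assms by auto
  ultimately show ?thesis by simp
qed

lemma frame_sum_cnj_mult:
  assumes "orthonormal_frame B"
  shows "(\<Sum>b\<in>B. oct_cnj b \<odot> (b \<odot> a)) = 8 *\<^sub>R a"
proof -
  have "(\<Sum>b\<in>B. oct_cnj b \<odot> (b \<odot> a)) = (\<Sum>b\<in>B. 1 *\<^sub>R a)"
    by (rule sum.cong) (simp_all add: oct_cnj_mult_cancel orthonormal_frame_inner[OF assms])
  also have "\<dots> = 8 *\<^sub>R a"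
    using orthonormal_frame_card[OF assms] by (simp add: scaleR_conv_of_real flip: scaleR_left.sum)
  finally show ?thesis .
qed

lemma frame_sum_mult:
  assumes "orthonormal_frame B"
  shows "(\<Sum>b\<in>B. (y \<bullet> b) *\<^sub>R (b \<odot> a)) = y \<odot> a"
proof -
  have "(\<Sum>b\<in>B. (y \<bullet> b) *\<^sub>R (b \<odot> a)) = (\<Sum>b\<in>B. (y \<bullet> b) *\<^sub>R b) \<odot> a"
    by (simp add: oct_mult.sum_left oct_mult.scaleR_left)
  then show ?thesis by (simp add: orthonormal_frame_expand[OF assms])
qed

text \<open>
  Equal to 1 on the ball of radius \<open>R\<close> about \<open>a\<close> and to 0 outside the ball of radius \<open>2R\<close>.
\<close>

definition radial_cutoff :: "'a::euclidean_space \<Rightarrow> real \<Rightarrow> 'a \<Rightarrow> real" where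
  "radial_cutoff a R y = cutoff (((y - a) \<bullet> (y - a)) / R\<^sup>2)"

definition radial_cutoff_grad :: "'a::euclidean_space \<Rightarrow> real \<Rightarrow> 'a \<Rightarrow> 'a" where
  "radial_cutoff_grad a R y = (2 * cutoff' (((y - a) \<bullet> (y - a)) / R\<^sup>2) / R\<^sup>2) *\<^sub>R (y - a)"

text \<open>
  Let \<open>E\<close> be the regularised kernel and \<open>\<theta>\<close> the cutoff. The function \<open>\<Sum>\<^sub>b \<partial>\<^sub>b (\<theta> E(b h))\<close> integrates to 0.
  It consists of three parts: \<open>E((\<nabla>\<theta>)h)\<close>, which is the pairing on the right; \<open>\<theta> \<Sum>\<^sub>b (\<partial>\<^sub>bE)(b h)\<close>, which is the
  approximate identity; and \<open>\<theta> E(\<Sum>\<^sub>b b \<partial>\<^sub>bh) = 0\<close>. With \<open>n = |y - x|\<^sup>2 + e\<^sup>2\<close>, the second part is computed from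
  \<open>\<Sum>\<^sub>b b\<^sup>c(b h) = 8h\<close> and \<open>z\<^sup>c(z h) = |z|\<^sup>2h\<close> as \<open>8h/n\<^sup>4 - 8|y - x|\<^sup>2h/n\<^sup>5 = 8e\<^sup>2h/n\<^sup>5\<close>.
\<close>

lemma monogenic_cauchy_identity:
  fixes a x c :: octonion and R e :: real
  assumes B: "orthonormal_frame B" and U: "open U" and h: "monogenic_in_frame B U h d"
    and R: "R > 0" "cball a (2 * R) \<subseteq> U" and e: "e \<noteq> 0" and box: "cball a (2 * R) \<subseteq> cbox l r"
  shows "continuous_on UNIV (\<lambda>y. radial_cutoff a R y *\<^sub>R h y)" "continuous_on UNIV (\<lambda>y. radial_cutoff_grad a R y \<odot> h y)"
    "8 * integral (cbox l r) (\<lambda>y. e\<^sup>2 / ((y - x) \<bullet> (y - x) + e\<^sup>2) ^ 5 * (radial_cutoff a R y *\<^sub>R h y \<bullet> c))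
      = - integral (cbox l r) (cauchy_pairing c (\<lambda>y. radial_cutoff_grad a R y \<odot> h y) x e)"
proof -
  have der: "((\<lambda>t. h (y + t *\<^sub>R b)) has_vector_derivative d b y) (at 0)" if "b \<in> B" "y \<in> U" for b y
    using h that by (simp add: monogenic_in_frame_def)
  have contd: "continuous_on U (d b)" if "b \<in> B" for b
    using h that by (simp add: monogenic_in_frame_def)
  have D0: "(\<Sum>b\<in>B. b \<odot> d b y) = 0" if "y \<in> U" for y
    using h that by (simp add: monogenic_in_frame_def)
  have conth: "continuous_on U h"
    using continuous_on_if_C1_partials[OF B U der contd] .
  have contf: "continuous_on S (radial_cutoff a R)" "continuous_on S (radial_cutoff_grad a R)" for S
    unfolding radial_cutoff_def[abs_def] radial_cutoff_grad_def[abs_def] using R by (auto intro!: continuous_intros)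
  define K where "K = cball a (2 * R)"
  have K: "closed K" "K \<subseteq> U" "K \<subseteq> cbox l r" using R box by (auto simp: K_def)
  have out: "radial_cutoff a R y = 0" "radial_cutoff_grad a R y = 0" if "y \<notin> K" for y
  proof -
    have "2 * R\<^sup>2 \<le> (2 * R)\<^sup>2" by (simp add: power_mult_distrib)
    also have "\<dots> \<le> (norm (y - a))\<^sup>2"
      using that R by (intro power_mono) (auto simp: K_def dist_norm norm_minus_commute)
    finally have "2 \<le> (y - a) \<bullet> (y - a) / R\<^sup>2"
      using R by (simp add: power2_norm_eq_inner pos_le_divide_eq)
    then show "radial_cutoff a R y = 0" "radial_cutoff_grad a R y = 0" by (simp_all add: radial_cutoff_def radial_cutoff_grad_def cutoff_outside)
  qed
  note supported = continuous_on_UNIV_if_supported[OF U K(1,2)]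
  show cont1: "continuous_on UNIV (\<lambda>y. radial_cutoff a R y *\<^sub>R h y)"
    by (rule supported) (auto intro!: continuous_intros conth contf simp: out)
  show cont2: "continuous_on UNIV (\<lambda>y. radial_cutoff_grad a R y \<odot> h y)"
    by (rule supported) (auto intro!: continuous_intros conth contf simp: out oct_mult.zero_left)
  define n where "n y = (y - x) \<bullet> (y - x) + e\<^sup>2" for y
  have n0: "n y \<noteq> 0" for y
    unfolding n_def using e by (metis add_nonneg_eq_0_iff inner_ge_zero zero_eq_power2 zero_le_power2)
  \<comment> \<open>\<open>E'\<close> is the derivative of the kernel \<open>E\<close> along \<open>b\<close>, and \<open>u'\<close> that of \<open>u\<close>.\<close>
  define E where "E y = (1 / n y ^ 4) *\<^sub>R oct_cnj (y - x)" for y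
  define E' where "E' b y = (1 / n y ^ 4) *\<^sub>R oct_cnj b - (8 * ((y - x) \<bullet> b) / n y ^ 5) *\<^sub>R oct_cnj (y - x)" for b y
  have contE: "continuous_on S n" "continuous_on S E" "continuous_on S (E' b)" for S b
    unfolding E_def E'_def using n0 unfolding n_def by (auto intro!: continuous_intros)
  define u where "u b y = radial_cutoff a R y * ((E y \<odot> (b \<odot> h y)) \<bullet> c)" for b y
  define u' where "u' b y = (radial_cutoff_grad a R y \<bullet> b) * ((E y \<odot> (b \<odot> h y)) \<bullet> c)
      + radial_cutoff a R y * ((E' b y \<odot> (b \<odot> h y)) \<bullet> c + (E y \<odot> (b \<odot> d b y)) \<bullet> c)" for b y
  have contu: "continuous_on UNIV (u b)" for b
    unfolding u_def by (rule supported) (auto intro!: continuous_intros conth contf contE simp: out)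
  have contu': "continuous_on UNIV (u' b)" if "b \<in> B" for b
    unfolding u'_def 
    by (rule supported) (auto intro!: continuous_intros conth contf contE contd that simp: out)
  have deru: "((\<lambda>t. u b (y + t *\<^sub>R b)) has_real_derivative u' b y) (at 0)" if b: "b \<in> B" for b y
  proof (cases "y \<in> K")
    case False
    have "open (- K)" using K by (simp add: open_Compl)
    then have "eventually (\<lambda>z. z \<in> - K) (nhds (y + 0 *\<^sub>R b))"
      using False by (intro eventually_nhds_in_open) auto
    moreover have "filterlim (\<lambda>t. y + t *\<^sub>R b) (nhds (y + 0 *\<^sub>R b)) (nhds (0::real))"
      by (intro tendsto_intros filterlim_ident)
    ultimately have "eventually (\<lambda>t. y + t *\<^sub>R b \<in> - K) (nhds 0)"
      by (rule eventually_compose_filterlim)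
    then have "eventually (\<lambda>t. u b (y + t *\<^sub>R b) = 0) (nhds 0)"
      by eventually_elim (simp add: u_def out)
    moreover have "u' b y = 0" using False by (simp add: u'_def out)
    ultimately show ?thesis
      using DERIV_cong_ev[of 0 0 "\<lambda>t. u b (y + t *\<^sub>R b)" "\<lambda>t. 0" "u' b y" 0] by simp
  next
    case True
    then have y: "y \<in> U" using K by auto
    have dcut: "((\<lambda>t. radial_cutoff a R (y + t *\<^sub>R b)) has_real_derivative radial_cutoff_grad a R y \<bullet> b) (at 0)"
    proof -
      have "((\<lambda>t. ((y + t *\<^sub>R b - a) \<bullet> (y + t *\<^sub>R b - a)) / R\<^sup>2) has_real_derivative 2 * ((y - a) \<bullet> b) / R\<^sup>2) (at 0)"
      proof -
        have "((\<lambda>t. ((y - a) \<bullet> (y - a) + t * (2 * ((y - a) \<bullet> b)) + t\<^sup>2 * (b \<bullet> b)) / R\<^sup>2) has_real_derivative 2 * ((y - a) \<bullet> b) / R\<^sup>2) (at 0)"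
          by (rule DERIV_cdivide) (auto intro!: derivative_eq_intros)
        moreover have "(y + t *\<^sub>R b - a) \<bullet> (y + t *\<^sub>R b - a) = (y - a) \<bullet> (y - a) + t * (2 * ((y - a) \<bullet> b)) + t\<^sup>2 * (b \<bullet> b)" for t
          by (simp add: inner_add_left inner_add_right inner_diff_left inner_diff_right inner_commute power2_eq_square algebra_simps)
        ultimately show ?thesis by simp
      qed
      then show ?thesis
        unfolding radial_cutoff_def radial_cutoff_grad_def by (rule DERIV_cong[OF cutoff_has_derivative]) simp
    qed
    have dn: "((\<lambda>t. n (y + t *\<^sub>R b)) has_real_derivative 2 * ((y - x) \<bullet> b)) (at 0)"
    proof -
      have "((\<lambda>t. n y + t * (2 * ((y - x) \<bullet> b)) + t\<^sup>2 * (b \<bullet> b)) has_real_derivative 2 * ((y - x) \<bullet> b)) (at 0)"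
        by (auto intro!: derivative_eq_intros)
      moreover have "n (y + t *\<^sub>R b) = n y + t * (2 * ((y - x) \<bullet> b)) + t\<^sup>2 * (b \<bullet> b)" for t
        by (simp add: n_def inner_add_left inner_add_right inner_diff_left inner_diff_right inner_commute power2_eq_square algebra_simps)
      ultimately show ?thesis by simp
    qed
    have dn4: "((\<lambda>t. 1 / n (y + t *\<^sub>R b) ^ 4) has_real_derivative - (8 * ((y - x) \<bullet> b) / n y ^ 5)) (at 0)"
      by (rule derivative_eq_intros dn refl)+ (use n0 in \<open>auto simp: field_simps power_numeral_reduce\<close>)
    have dE: "((\<lambda>t. E (y + t *\<^sub>R b)) has_vector_derivative E' b y) (at 0)"
    proof -
      have "((\<lambda>t. oct_cnj (y - x) + t *\<^sub>R oct_cnj b) has_vector_derivative oct_cnj b) (at 0)"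
        by (auto intro!: derivative_eq_intros)
      moreover have "oct_cnj (y + t *\<^sub>R b - x) = oct_cnj (y - x) + t *\<^sub>R oct_cnj b" for t
        by (simp add: linear_diff[OF linear_oct_cnj] linear_add[OF linear_oct_cnj] linear_scale[OF linear_oct_cnj])
      ultimately have "((\<lambda>t. oct_cnj (y + t *\<^sub>R b - x)) has_vector_derivative oct_cnj b) (at 0)" by simp
      from has_vector_derivative_scaleR[OF dn4 this] show ?thesis
        by (simp add: E_def E'_def)
    qed
    have "((\<lambda>t. b \<odot> h (y + t *\<^sub>R b)) has_vector_derivative b \<odot> d b y) (at 0)"
      by (rule bounded_linear.has_vector_derivative[OF oct_mult.bounded_linear_right der[OF b y]])
    from oct_mult.has_vector_derivative[OF dE this]
    have "((\<lambda>t. E (y + t *\<^sub>R b) \<odot> (b \<odot> h (y + t *\<^sub>R b))) has_vector_derivative 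
        E y \<odot> (b \<odot> d b y) + E' b y \<odot> (b \<odot> h y)) (at 0)" by simp
    from bounded_linear.has_vector_derivative[OF bounded_linear_inner_left this, of c]
    have "((\<lambda>t. (E (y + t *\<^sub>R b) \<odot> (b \<odot> h (y + t *\<^sub>R b))) \<bullet> c) has_real_derivative 
        (E y \<odot> (b \<odot> d b y)) \<bullet> c + (E' b y \<odot> (b \<odot> h y)) \<bullet> c) (at 0)"
      by (simp add: has_real_derivative_iff_has_vector_derivative inner_add_left)
    from DERIV_mult[OF dcut this] show ?thesis
      unfolding u_def u'_def by (simp add: algebra_simps)
  qed
  have int0: "integral (cbox l r) (u' b) = 0" if "b \<in> B" for b
  proof (rule integral_directional_derivative_eq_0[where u = "u b"])
    show "u b y = 0" if "y \<notin> cbox l r" for y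
      using out K that by (auto simp: u_def)
  qed (use deru contu contu' that in auto)
  have sum_u': "(\<Sum>b\<in>B. u' b y) = cauchy_pairing c (\<lambda>y. radial_cutoff_grad a R y \<odot> h y) x e y
      + 8 * (e\<^sup>2 / n y ^ 5 * (radial_cutoff a R y *\<^sub>R h y \<bullet> c))" for y
  proof -
    have t1: "(\<Sum>b\<in>B. (radial_cutoff_grad a R y \<bullet> b) * ((E y \<odot> (b \<odot> h y)) \<bullet> c)) = cauchy_pairing c (\<lambda>y. radial_cutoff_grad a R y \<odot> h y) x e y"
    proof -
      have "(\<Sum>b\<in>B. (radial_cutoff_grad a R y \<bullet> b) * ((E y \<odot> (b \<odot> h y)) \<bullet> c)) = (E y \<odot> (\<Sum>b\<in>B. (radial_cutoff_grad a R y \<bullet> b) *\<^sub>R (b \<odot> h y))) \<bullet> c"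
        by (simp add: oct_mult.sum_right oct_mult.scaleR_right inner_sum_left)
      also have "\<dots> = cauchy_pairing c (\<lambda>y. radial_cutoff_grad a R y \<odot> h y) x e y"
        by (simp add: frame_sum_mult[OF B] cauchy_pairing_def E_def n_def oct_mult.scaleR_left)
      finally show ?thesis .
    qed
    have t2: "(\<Sum>b\<in>B. (E' b y \<odot> (b \<odot> h y)) \<bullet> c) = 8 * (e\<^sup>2 / n y ^ 5 * (h y \<bullet> c))"
    proof -
      have "(\<Sum>b\<in>B. E' b y \<odot> (b \<odot> h y)) = (1 / n y ^ 4) *\<^sub>R (\<Sum>b\<in>B. oct_cnj b \<odot> (b \<odot> h y))
         - (8 / n y ^ 5) *\<^sub>R (oct_cnj (y - x) \<odot> (\<Sum>b\<in>B. ((y - x) \<bullet> b) *\<^sub>R (b \<odot> h y)))"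
        by (simp add: E'_def oct_mult.diff_left oct_mult.scaleR_left oct_mult.scaleR_right oct_mult.sum_right scaleR_sum_right sum_subtractf)
      also have "\<dots> = (8 / n y ^ 4 - 8 / n y ^ 5 * ((y - x) \<bullet> (y - x))) *\<^sub>R h y"
        unfolding frame_sum_mult[OF B] frame_sum_cnj_mult[OF B]
        unfolding oct_cnj_mult_cancel by (simp add: scaleR_left_diff_distrib)
      also have "8 / n y ^ 4 - 8 / n y ^ 5 * ((y - x) \<bullet> (y - x)) = 8 * (e\<^sup>2 / n y ^ 5)"
      proof -
        have "(y - x) \<bullet> (y - x) = n y - e\<^sup>2" by (simp add: n_def)
        then show ?thesis using n0[of y] by (simp add: field_simps power_numeral_reduce)
      qed
      finally show ?thesis by (simp flip: inner_sum_left)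
    qed
    have t3: "radial_cutoff a R y * (\<Sum>b\<in>B. (E y \<odot> (b \<odot> d b y)) \<bullet> c) = 0"
    proof (cases "y \<in> K")
      case True
      have "(\<Sum>b\<in>B. (E y \<odot> (b \<odot> d b y)) \<bullet> c) = (E y \<odot> (\<Sum>b\<in>B. b \<odot> d b y)) \<bullet> c"
        by (simp add: oct_mult.sum_right inner_sum_left)
      then show ?thesis using D0[of y] True K by (auto simp: oct_mult.zero_right)
    qed (simp add: out)
    have "(\<Sum>b\<in>B. u' b y) = (\<Sum>b\<in>B. (radial_cutoff_grad a R y \<bullet> b) * ((E y \<odot> (b \<odot> h y)) \<bullet> c))
      + radial_cutoff a R y * (\<Sum>b\<in>B. (E' b y \<odot> (b \<odot> h y)) \<bullet> c) + radial_cutoff a R y * (\<Sum>b\<in>B. (E y \<odot> (b \<odot> d b y)) \<bullet> c)"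
      by (simp add: u'_def sum.distrib sum_distrib_left distrib_left)
    then show ?thesis unfolding t1 t2 t3 by simp
  qed
  have finB: "finite B" using B by (simp add: orthonormal_frame_def)
  have intble: "g integrable_on cbox l r" if "continuous_on UNIV g" for g :: "octonion \<Rightarrow> real"
    by (rule integrable_continuous[OF continuous_on_subset[OF that]]) simp
  have cont3: "continuous_on UNIV (\<lambda>y. e\<^sup>2 / n y ^ 5 * (radial_cutoff a R y *\<^sub>R h y \<bullet> c))"
    using n0 by (intro continuous_intros cont1 contE) auto
  have cont4: "continuous_on UNIV (cauchy_pairing c (\<lambda>y. radial_cutoff_grad a R y \<odot> h y) x e)"
    unfolding cauchy_pairing_def using n0 by (intro continuous_intros cont2) (auto simp: n_def)
  have "0 = integral (cbox l r) (\<lambda>y. \<Sum>b\<in>B. u' b y)"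
    using int0 by (subst integral_sum[OF finB]) (auto intro!: intble contu')
  also have "\<dots> = integral (cbox l r) (cauchy_pairing c (\<lambda>y. radial_cutoff_grad a R y \<odot> h y) x e)
     + 8 * integral (cbox l r) (\<lambda>y. e\<^sup>2 / n y ^ 5 * (radial_cutoff a R y *\<^sub>R h y \<bullet> c))"
    unfolding sum_u' 
    by (simp only: integral_add[OF intble[OF cont4] intble[OF continuous_on_mult_left[OF cont3]]] integral_mult_right)
  finally show "8 * integral (cbox l r) (\<lambda>y. e\<^sup>2 / ((y - x) \<bullet> (y - x) + e\<^sup>2) ^ 5 * (radial_cutoff a R y *\<^sub>R h y \<bullet> c))
      = - integral (cbox l r) (cauchy_pairing c (\<lambda>y. radial_cutoff_grad a R y \<odot> h y) x e)"
    by (simp add: n_def)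
qed

section \<open>Unique continuation\<close>

text \<open>
  Letting \<open>e \<rightarrow> 0\<close> in the Cauchy identity: where \<open>h\<close> vanishes locally, so does the limit \<open>J x 0\<close> of the
  right-hand side. By analyticity along segments \<open>J\<close> then vanishes on the whole small ball, and
  a nonzero value \<open>h x0\<close> would contradict the lower bound for the approximate identity, taken in
  the direction \<open>c = h x0\<close>. The radius \<open>R/4\<close> depends only on the distance of \<open>a\<close> to the boundary of \<open>U\<close>, not on
  \<open>W\<close>; this uniformity is what lets the zero set spread.
\<close>

lemma monogenic_local_unique_continuation:
  assumes B: "orthonormal_frame B" and U: "open U" and h: "monogenic_in_frame B U h d"
    and R: "R > 0" "cball a (2 * R) \<subseteq> U"
    and W: "open W" and x1: "x1 \<in> W" "x1 \<in> ball a (R / 4)" and hW: "\<And>x. x \<in> W \<Longrightarrow> h x = 0"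
    and x0: "x0 \<in> ball a (R / 4)"
  shows "h x0 = 0"
proof (rule ccontr)
  assume ne: "h x0 \<noteq> 0"
  define c where "c = h x0"
  obtain w where w: "cball a (2 * R) \<subseteq> box (- w) w"
    using bounded_subset_box_symmetric[OF bounded_cball] by blast
  then have w': "cball a (2 * R) \<subseteq> cbox (- w) w" using box_subset_cbox by blast
  define bub where "bub x e = integral (cbox (- w) w) (\<lambda>y. e\<^sup>2 / ((y - x) \<bullet> (y - x) + e\<^sup>2) ^ 5 * (radial_cutoff a R y *\<^sub>R h y \<bullet> c))" for x and e :: real
  define J where "J x e = integral (cbox (- w) w) (cauchy_pairing c (\<lambda>y. radial_cutoff_grad a R y \<odot> h y) x e)" for x e
  note cauchy = monogenic_cauchy_identity[OF B U h R _ w']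
  have cont: "continuous_on UNIV (\<lambda>y. radial_cutoff a R y *\<^sub>R h y)" "continuous_on UNIV (\<lambda>y. radial_cutoff_grad a R y \<odot> h y)"
    using cauchy(1,2)[of 1] by auto
  have contc: "continuous_on UNIV (\<lambda>y. radial_cutoff a R y *\<^sub>R h y \<bullet> c)"
    by (intro continuous_intros cont)
  have inside: "radial_cutoff a R y = 1" "radial_cutoff_grad a R y = 0" if "y \<in> cball a R" for y
  proof -
    have "(norm (y - a))\<^sup>2 \<le> R\<^sup>2"
      using that by (intro power_mono) (auto simp: dist_norm norm_minus_commute)
    then have "(y - a) \<bullet> (y - a) / R\<^sup>2 \<le> 1" using R by (simp add: power2_norm_eq_inner)
    then show "radial_cutoff a R y = 1" "radial_cutoff_grad a R y = 0" by (simp_all add: radial_cutoff_def radial_cutoff_grad_def cutoff_inside)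
  qed
  have J0: "radial_cutoff_grad a R y \<odot> h y = 0" if "y \<in> cball a R" for y
    using inside[OF that] by (simp add: oct_mult.zero_left)
  have bub_J: "bub x e = - J x e / 8" if "e \<noteq> 0" for x e
    using cauchy(3)[OF that, of x c] by (simp add: bub_def J_def)
  have lim: "(bub x \<longlongrightarrow> - J x 0 / 8) (at 0)" if "x \<in> ball a (R / 4)" for x
  proof -
    have "x \<in> ball a R" using that R by auto
    then have "(J x \<longlongrightarrow> J x 0) (at 0)"
      unfolding J_def by (intro cauchy_integral_tendsto[OF cont(2) J0])
    then have "((\<lambda>e. - J x e / 8) \<longlongrightarrow> - J x 0 / 8) (at 0)" by (intro tendsto_intros) auto
    moreover have "\<forall>\<^sub>F e in at 0. - J x e / 8 = bub x e"
      using bub_J by (auto simp: eventually_at_filter)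
    ultimately show ?thesis by (rule Lim_transform_eventually)
  qed
  have JW: "J x 0 = 0" if x: "x \<in> W \<inter> ball a (R / 4)" for x
  proof -
    obtain \<delta> where "\<delta> > 0" "cball x \<delta> \<subseteq> W" using W x open_contains_cball by blast
    then have "(bub x \<longlongrightarrow> 0) (at 0)"
      unfolding bub_def by (intro bubble_integral_tendsto_0[OF contc, of \<delta>]) (auto simp: hW subset_iff)
    then have "- J x 0 / 8 = 0" using lim x by (intro tendsto_unique[of "at 0" "bub x"]) auto
    then show ?thesis by simp
  qed
  have "J x0 0 = 0"
    unfolding J_def
  proof (rule cauchy_integral_unique_continuation[OF cont(2) J0])
    show "open (W \<inter> ball a (R / 4))" "x1 \<in> W \<inter> ball a (R / 4)" using W x1 by auto
    show "integral (cbox (- w) w) (cauchy_pairing c (\<lambda>y. radial_cutoff_grad a R y \<odot> h y) x 0) = 0"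
      if "x \<in> W \<inter> ball a (R / 4)" for x
      using JW[OF that] by (simp add: J_def)
  qed (use x1 x0 in auto)
  then have "(bub x0 \<longlongrightarrow> 0) (at 0)" using lim[OF x0] by simp
  moreover have "\<not> (bub x0 \<longlongrightarrow> 0) (at 0)"
    unfolding bub_def
  proof (rule bubble_integral_not_tendsto_0[OF contc])
    have "x0 \<in> cball a R" using x0 R by auto
    then show "radial_cutoff a R x0 *\<^sub>R h x0 \<bullet> c > 0" using inside ne by (simp add: c_def)
    have "x0 \<in> cball a (2 * R)" using x0 R by auto
    then show "x0 \<in> box (- w) w" using w by blast
  qed
  ultimately show False by simp
qed

text \<open>
  The interior of the zero set is relatively closed: a limit point \<open>x\<close> of it has a ball around it whose
  size depends on \<open>U\<close> only, and the local result applies to that ball.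
\<close>

theorem monogenic_unique_continuation:
  assumes B: "orthonormal_frame B" and U: "open U" "connected U" and h: "monogenic_in_frame B U h d"
    and W: "open W" "W \<noteq> {}" "W \<subseteq> U" and hW: "\<And>x. x \<in> W \<Longrightarrow> h x = 0" and x: "x \<in> U"
  shows "h x = 0"
proof -
  define Z where "Z = U \<inter> interior {y. h y = 0}"
  have near: "x \<in> Z" if x: "x \<in> U" and lim: "x islimpt Z \<or> x \<in> Z" for x
  proof -
    obtain r where "r > 0" "cball x r \<subseteq> U" using U x open_contains_cball by blast
    define R where "R = r / 2"
    have R: "R > 0" "cball x (2 * R) \<subseteq> U" using \<open>r > 0\<close> \<open>cball x r \<subseteq> U\<close> by (auto simp: R_def)
    obtain z where z: "z \<in> Z" "z \<in> ball x (R / 4)"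
    proof (cases "x \<in> Z")
      case True
      then show ?thesis using that[of x] R by auto
    next
      case False
      then have "x islimpt Z" using lim by auto
      then show ?thesis using that R islimptE[of x Z "ball x (R / 4)"] by (auto simp del: mem_ball)
    qed
    have "z \<in> interior {y. h y = 0}" using z(1) by (simp add: Z_def)
    then obtain \<delta> where "\<delta> > 0" "ball z \<delta> \<subseteq> {y. h y = 0}"
      unfolding mem_interior by blast
    then have \<delta>: "\<delta> > 0" "\<And>y. y \<in> ball z \<delta> \<Longrightarrow> h y = 0" by auto
    have "h y = 0" if "y \<in> ball x (R / 4)" for y
      using monogenic_local_unique_continuation[OF B U(1) h R open_ball[of z \<delta>] _ z(2) \<delta>(2) that] \<delta>(1) by simp
    then have "ball x (R / 4) \<subseteq> {y. h y = 0}" by blast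
    then have "x \<in> interior {y. h y = 0}" using R by (intro interiorI[of "ball x (R / 4)"]) auto
    then show ?thesis using x by (simp add: Z_def)
  qed
  have "openin (top_of_set U) Z"
    by (simp add: openin_open_eq U Z_def open_Int)
  moreover have "closedin (top_of_set U) Z"
    unfolding closedin_limpt using near by (auto simp: Z_def)
  moreover have "W \<subseteq> Z"
    using W hW interior_maximal[of W "{y. h y = 0}"] by (auto simp: Z_def)
  ultimately have "Z = U" using U(2) W(2) by (auto simp: connected_clopen)
  then show ?thesis using x interior_subset[of "{y. h y = 0}"] by (auto simp: Z_def)
qed

text \<open>
  On the hyperplane \<open>y \<bullet> w = 0\<close> the derivatives of \<open>h\<close> along the other frame vectors vanish because \<open>h\<close>
  does. The equation reduces to \<open>w (\<partial>\<^sub>w h) = 0\<close> there, and \<open>w\<close> can be cancelled. Since \<open>h\<close> and all its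
  derivatives vanish on the hyperplane, extending \<open>h\<close> by 0 across it preserves continuous differentiability.
\<close>

lemma monogenic_zero_extension:
  assumes B: "orthonormal_frame B" and w: "w \<in> B" and U: "open U" and h: "monogenic_in_frame B U h d"
    and zero: "\<And>y. y \<in> U \<Longrightarrow> y \<bullet> w = 0 \<Longrightarrow> h y = 0"
  shows "monogenic_in_frame B U (\<lambda>y. if y \<bullet> w \<le> 0 then 0 else h y) (\<lambda>b y. if y \<bullet> w \<le> 0 then 0 else d b y)"
proof -
  have der: "((\<lambda>t. h (y + t *\<^sub>R b)) has_vector_derivative d b y) (at 0)" if "b \<in> B" "y \<in> U" for b y
    using h that by (simp add: monogenic_in_frame_def)
  have D0: "(\<Sum>b\<in>B. b \<odot> d b y) = 0" if "y \<in> U" for y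
    using h that by (simp add: monogenic_in_frame_def)
  have finB: "finite B" using B by (simp add: orthonormal_frame_def)
  have line: "open {t. y + t *\<^sub>R b \<in> V}" if "open V" for V and y b :: octonion
    using open_vimage[OF that, of "\<lambda>t. y + t *\<^sub>R b"] by (simp add: vimage_def continuous_intros)
  have tangential: "d b y = 0" if b: "b \<in> B" "b \<noteq> w" and y: "y \<in> U" "y \<bullet> w = 0" for b y
  proof -
    have "b \<bullet> w = 0" using orthonormal_frame_inner[OF B b(1) w] b by simp
    then have "((\<lambda>t. h (y + t *\<^sub>R b)) has_vector_derivative 0) (at 0)"
      using y zero
      by (intro has_vector_derivative_transform_within_open[OF has_vector_derivative_const line[OF U, of y b]])
         (auto simp: inner_add_left)
    then show ?thesis using vector_derivative_unique_at der b y by blast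
  qed
  have normal: "d w y = 0" if y: "y \<in> U" "y \<bullet> w = 0" for y
  proof -
    have "(\<Sum>b\<in>B. b \<odot> d b y) = w \<odot> d w y"
      using tangential y by (subst sum.remove[OF finB w]) (auto intro!: sum.neutral simp: oct_mult.zero_right)
    then have "w \<odot> d w y = 0" using D0 y by simp
    then have "(w \<bullet> w) *\<^sub>R d w y = 0" by (simp flip: oct_cnj_mult_cancel add: oct_mult.zero_right)
    then show ?thesis by (simp add: orthonormal_frame_inner[OF B w w])
  qed
  have d0: "d b y = 0" if "b \<in> B" "y \<in> U" "y \<bullet> w = 0" for b y
    using normal tangential that by (cases "b = w") auto
  let ?h = "\<lambda>y. if y \<bullet> w \<le> 0 then 0 else h y" and ?d = "\<lambda>b y. if y \<bullet> w \<le> 0 then 0 else d b y"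
  have "((\<lambda>t. ?h (y + t *\<^sub>R b)) has_vector_derivative ?d b y) (at 0)" if b: "b \<in> B" and y: "y \<in> U" for b y
  proof -
    consider "y \<bullet> w < 0" | "y \<bullet> w > 0" | "y \<bullet> w = 0" by linarith
    then show ?thesis
    proof cases
      case 1
      have "open {y. y \<bullet> w < 0}" by (intro open_Collect_less continuous_intros)
      from line[OF this, of y b] have "((\<lambda>t. ?h (y + t *\<^sub>R b)) has_vector_derivative 0) (at 0)"
        by (rule has_vector_derivative_transform_within_open[OF has_vector_derivative_const]) (use 1 in auto)
      with 1 show ?thesis by simp
    next
      case 2
      have "open {y. 0 < y \<bullet> w}" by (intro open_Collect_less continuous_intros)
      from line[OF this, of y b] have "((\<lambda>t. ?h (y + t *\<^sub>R b)) has_vector_derivative d b y) (at 0)"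
        by (rule has_vector_derivative_transform_within_open[OF der[OF b y]]) (use 2 in auto)
      with 2 show ?thesis by simp
    next
      case 3
      have "((\<lambda>t. h (y + t *\<^sub>R b)) has_vector_derivative 0) (at 0)"
        using der[OF b y] d0[OF b y 3] by simp
      then have "((\<lambda>t. norm (h (y + t *\<^sub>R b)) / norm t) \<longlongrightarrow> 0) (at 0)"
        unfolding has_vector_derivative_def has_derivative_at using zero[OF y 3] by simp
      \<comment> \<open>At a point of the hyperplane the truncated difference quotient is dominated by the full one.\<close>
      then have "((\<lambda>t. norm (?h (y + t *\<^sub>R b)) / norm t) \<longlongrightarrow> 0) (at 0)"
        by (rule Lim_null_comparison[rotated]) (auto intro!: always_eventually)
      then show ?thesis
        unfolding has_vector_derivative_def has_derivative_at using 3 by (simp cong: if_cong)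
    qed
  qed
  moreover have "continuous_on U (?d b)" if b: "b \<in> B" for b
    using h that d0[OF b]
    by (intro continuous_on_cases_le) 
       (auto simp: monogenic_in_frame_def intro!: continuous_intros intro: continuous_on_subset)
  moreover have "(\<Sum>b\<in>B. b \<odot> ?d b y) = 0" if "y \<in> U" for y
    by (cases "y \<bullet> w \<le> 0") (simp_all add: D0[OF that] oct_mult.zero_right)
  ultimately show ?thesis
    unfolding monogenic_in_frame_def by blast
qed

theorem monogenic_zero_on_hyperplane:
  assumes B: "orthonormal_frame B" and w: "w \<in> B" and U: "open U" "connected U" and h: "monogenic_in_frame B U h d"
    and zero: "\<And>y. y \<in> U \<Longrightarrow> y \<bullet> w = 0 \<Longrightarrow> h y = 0" and a: "a \<in> U" "a \<bullet> w = 0" and x: "x \<in> U"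
  shows "h x = 0"
proof -
  let ?h = "\<lambda>y. if y \<bullet> w \<le> 0 then 0 else h y"
  have ww: "w \<bullet> w = 1" using orthonormal_frame_inner[OF B w w] by simp
  obtain \<delta> where \<delta>: "\<delta> > 0" "cball a \<delta> \<subseteq> U" using U a open_contains_cball by blast
  have mem: "a + s *\<^sub>R w \<in> U" if "\<bar>s\<bar> \<le> \<delta>" for s
    using that \<delta> ww by (auto simp: subset_iff dist_norm norm_eq_sqrt_inner)
  have zero_pos: "h y = 0" if "y \<in> U" "y \<bullet> w > 0" for y
  proof -
    have "?h y = 0"
    proof (rule monogenic_unique_continuation[OF B U monogenic_zero_extension[OF B w U(1) h zero]])
      show "open (U \<inter> {y. y \<bullet> w < 0})" using U by (intro open_Int open_Collect_less continuous_intros)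
      show "U \<inter> {y. y \<bullet> w < 0} \<noteq> {}"
        using mem[of "- \<delta>"] \<delta> a ww by (auto simp: inner_diff_left intro!: exI[of _ "a - \<delta> *\<^sub>R w"])
    qed (use that in auto)
    then show ?thesis using that by simp
  qed
  show ?thesis
  proof (rule monogenic_unique_continuation[OF B U h])
    show "open (U \<inter> {y. 0 < y \<bullet> w})" using U by (intro open_Int open_Collect_less continuous_intros)
    show "U \<inter> {y. 0 < y \<bullet> w} \<noteq> {}"
      using mem[of \<delta>] \<delta> a ww by (auto simp: inner_add_left intro!: exI[of _ "a + \<delta> *\<^sub>R w"])
  qed (use zero_pos x in auto)
qed

section \<open>Slices\<close>

lemma of_nat_8_eq_iff: "i \<le> 7 \<Longrightarrow> j \<le> 7 \<Longrightarrow> (of_nat i :: 8) = of_nat j \<longleftrightarrow> i = j"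
proof -
  assume "i \<le> 7" "j \<le> 7"
  then have "i \<in> {0, 1, 2, 3, 4, 5, 6, 7}" "j \<in> {0, 1, 2, 3, 4, 5, 6, 7}" by auto
  then show ?thesis by (elim insertE emptyE) simp_all
qed

lemma oct_e_inner: "i \<le> 7 \<Longrightarrow> j \<le> 7 \<Longrightarrow> oct_e i \<bullet> oct_e j = (if i = j then 1 else 0)"
  by (simp add: oct_e_def inner_axis_axis of_nat_8_eq_iff)

lemma oct_e_eq_iff: "i \<le> 7 \<Longrightarrow> j \<le> 7 \<Longrightarrow> oct_e i = oct_e j \<longleftrightarrow> i = j"
  by (metis oct_e_inner zero_neq_one)

text \<open>
  The orthogonal projection onto \<open>oct_para p\<close>.
\<close>

definition para_proj :: "nat \<Rightarrow> octonion \<Rightarrow> octonion" where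
  "para_proj p y = (\<Sum>i=0..p. (y \<bullet> oct_e i) *\<^sub>R oct_e i)"

lemma linear_para_proj: "linear (para_proj p)"
  by (rule linearI) (simp_all add: para_proj_def inner_add_left scaleR_left_distrib sum.distrib scaleR_sum_right)

lemma continuous_on_para_proj [continuous_intros]:
  "continuous_on S g \<Longrightarrow> continuous_on S (\<lambda>y. para_proj p (g y))"
  unfolding para_proj_def by (intro continuous_intros)

lemma para_proj_in_para: "para_proj p y \<in> oct_para p"
  by (auto simp: oct_para_def para_proj_def)

context
  fixes p :: nat
  assumes p: "p \<le> 6"
begin

lemma para_inner_oct_e:
  assumes "i \<le> p"
  shows "(\<Sum>j=0..p. x j *\<^sub>R oct_e j) \<bullet> oct_e i = x i"
proof -
  have "(\<Sum>j=0..p. x j *\<^sub>R oct_e j) \<bullet> oct_e i = (\<Sum>j=0..p. if j = i then x j else 0)"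
    unfolding inner_sum_left using assms p by (intro sum.cong) (auto simp: oct_e_inner)
  then show ?thesis using assms by simp
qed

lemma oct_e_in_para:
  assumes "i \<le> p"
  shows "oct_e i \<in> oct_para p"
proof -
  have "(\<Sum>j=0..p. (if j = i then 1 else 0) *\<^sub>R oct_e j) = (\<Sum>j=0..p. if j = i then oct_e j else 0)"
    by (rule sum.cong) auto
  also have "\<dots> = oct_e i" using assms by simp
  finally show ?thesis
    unfolding oct_para_def by (intro CollectI exI[of _ "\<lambda>j. if j = i then 1 else 0"]) simp
qed

lemma para_proj_para: "x \<in> oct_para p \<Longrightarrow> para_proj p x = x"
  by (auto simp: oct_para_def para_proj_def para_inner_oct_e)

lemma sphere_inner_oct_e:
  assumes "w \<in> oct_sphere p" "i \<le> p"
  shows "w \<bullet> oct_e i = 0"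
proof -
  obtain x where "w = (\<Sum>j=p+1..7. x j *\<^sub>R oct_e j)" using assms by (auto simp: oct_sphere_def)
  then show ?thesis
    using assms p by (auto simp: inner_sum_left oct_e_inner intro!: sum.neutral)
qed

lemma sphere_inner_self:
  assumes "w \<in> oct_sphere p"
  shows "w \<bullet> w = 1"
proof -
  obtain x where w: "w = (\<Sum>j=p+1..7. x j *\<^sub>R oct_e j)" and 1: "(\<Sum>i=p+1..7. (x i)\<^sup>2) = 1"
    using assms by (auto simp: oct_sphere_def)
  have we: "w \<bullet> oct_e i = x i" if "i \<in> {p+1..7}" for i
  proof -
    have "w \<bullet> oct_e i = (\<Sum>j=p+1..7. if j = i then x j else 0)"
      unfolding w inner_sum_left using that by (intro sum.cong) (auto simp: oct_e_inner)
    then show ?thesis using that by simp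
  qed
  have "w \<bullet> w = (\<Sum>i=p+1..7. x i * (w \<bullet> oct_e i))"
    by (subst (2) w) (simp add: inner_sum_right)
  also have "\<dots> = 1" unfolding 1[symmetric] by (rule sum.cong) (simp_all add: we power2_eq_square)
  finally show ?thesis .
qed

lemma sphere_uminus:
  assumes "w \<in> oct_sphere p"
  shows "- w \<in> oct_sphere p"
proof -
  obtain x where "w = (\<Sum>j=p+1..7. x j *\<^sub>R oct_e j)" and "(\<Sum>i=p+1..7. (x i)\<^sup>2) = 1"
    using assms by (auto simp: oct_sphere_def)
  then have "- w = (\<Sum>j=p+1..7. (- x j) *\<^sub>R oct_e j)" "(\<Sum>i=p+1..7. (- x i)\<^sup>2) = 1"
    by (simp_all add: sum_negf)
  then show ?thesis
    unfolding oct_sphere_def by (intro CollectI exI[of _ "\<lambda>j. - x j"] conjI)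
qed

lemma para_proj_sphere: "w \<in> oct_sphere p \<Longrightarrow> para_proj p w = 0"
  by (simp add: para_proj_def sphere_inner_oct_e)

lemma para_inner_sphere: "x \<in> oct_para p \<Longrightarrow> w \<in> oct_sphere p \<Longrightarrow> x \<bullet> w = 0"
  by (auto simp: oct_para_def inner_sum_left inner_commute[of "oct_e _"] sphere_inner_oct_e intro!: sum.neutral)

text \<open>
  Partial symmetry for radii of either sign, as \<open>r\<close> is an arbitrary real coordinate on a slice.
\<close>

lemma p_symmetric_signed:
  assumes "p_symmetric p \<Omega>" "x \<in> oct_para p" "w \<in> oct_sphere p" "v \<in> oct_sphere p" "x + r *\<^sub>R w \<in> \<Omega>"
  shows "x + r *\<^sub>R v \<in> \<Omega>"
proof -
  consider "r = 0" | "r > 0" | "- r > 0" by linarith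
  then show ?thesis
  proof cases
    case 3
    have "x + (- r) *\<^sub>R (- w) \<in> \<Omega>" using assms by simp
    then have "x + (- r) *\<^sub>R (- v) \<in> \<Omega>"
      using assms 3 sphere_uminus unfolding p_symmetric_def by blast
    then show ?thesis by simp
  qed (use assms in \<open>auto simp: p_symmetric_def\<close>)
qed

lemma orthonormal_frame_extending_slice:
  assumes w: "w \<in> oct_sphere p"
  obtains B where "orthonormal_frame B" "insert w (oct_e ` {0..p}) \<subseteq> B"
proof -
  let ?S = "insert w (oct_e ` {0..p})"
  have "pairwise orthogonal ?S"
    using w p by (auto simp: pairwise_def orthogonal_def oct_e_inner sphere_inner_oct_e inner_commute)
  then obtain V where V: "V \<inter> insert 0 ?S = {}" "pairwise orthogonal (?S \<union> V)" "span (?S \<union> V) = span (?S \<union> UNIV)"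
    by (rule orthogonal_extension_strong)
  define B where "B = (\<lambda>v. (1 / norm v) *\<^sub>R v) ` (?S \<union> V)"
  have fin: "finite (?S \<union> V)" by (rule pairwise_orthogonal_imp_finite[OF V(2)])
  have norm1: "norm v = 1" if "v \<in> ?S" for v
    using that w p sphere_inner_self by (auto simp: norm_eq_1 oct_e_inner)
  have "0 \<notin> V" using V(1) by blast
  moreover have "0 \<notin> ?S" using norm1 norm_zero zero_neq_one by metis
  ultimately have ne: "v \<noteq> 0" if "v \<in> ?S \<union> V" for v using that by (metis UnE)
  have "pairwise orthogonal B"
  proof (rule pairwiseI)
    fix b c assume "b \<in> B" "c \<in> B" "b \<noteq> c"
    then obtain b' c' where bc: "b' \<in> ?S \<union> V" "c' \<in> ?S \<union> V" "b = (1 / norm b') *\<^sub>R b'" "c = (1 / norm c') *\<^sub>R c'"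
      unfolding B_def by (elim imageE)
    then have "orthogonal b' c'" using V(2) \<open>b \<noteq> c\<close> by (metis pairwiseD)
    then show "orthogonal b c" unfolding bc by (simp add: orthogonal_def)
  qed
  moreover have "\<forall>b\<in>B. norm b = 1" unfolding B_def using ne by auto
  moreover have "span B = UNIV"
    unfolding B_def using ne V(3) by (subst span_image_scale[OF fin]) auto
  moreover have "?S \<subseteq> B"
  proof
    fix v assume v: "v \<in> ?S"
    have "(1 / norm v) *\<^sub>R v \<in> B" unfolding B_def using v by blast
    then show "v \<in> B" by (simp add: norm1[OF v])
  qed
  moreover have "finite B" unfolding B_def using fin by (rule finite_imageI)
  ultimately have "orthonormal_frame B" "?S \<subseteq> B" by (simp_all only: orthonormal_frame_def simp_thms)
  then show ?thesis by (rule that)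
qed

text \<open>
  Uniqueness on a slice. Composing \<open>F\<close> with the orthogonal projection \<open>pr\<close> onto the slice space gives a
  function on an open subset of \<open>\<real>\<^sup>8\<close> that does not depend on the coordinates orthogonal to the slice, hence is
  monogenic in any orthonormal frame extending \<open>e\<^sub>0, \<dots>, e\<^sub>p, w\<close>.
\<close>

lemma slice_monogenic_zero_on_para:
  assumes w: "w \<in> oct_sphere p" and \<Omega>: "open \<Omega>" and conn: "connected (slice_of p \<Omega> w)"
    and derF: "\<And>v z. v \<in> insert w (oct_e ` {0..p}) \<Longrightarrow> z \<in> slice_of p \<Omega> w \<Longrightarrow>
      ((\<lambda>t. F (z + t *\<^sub>R v)) has_vector_derivative D v z) (at 0)"
    and contD: "\<And>v. v \<in> insert w (oct_e ` {0..p}) \<Longrightarrow> continuous_on (slice_of p \<Omega> w) (D v)"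
    and eq: "\<And>z. z \<in> slice_of p \<Omega> w \<Longrightarrow> (\<Sum>i=0..p. oct_e i \<odot> D (oct_e i) z) + w \<odot> D w z = 0"
    and zero: "\<And>x. x \<in> \<Omega> \<inter> oct_para p \<Longrightarrow> F x = 0"
    and ne: "\<Omega> \<inter> oct_para p \<noteq> {}"
    and z: "z \<in> slice_of p \<Omega> w"
  shows "F z = 0"
proof -
  let ?S = "insert w (oct_e ` {0..p})"
  obtain B where B: "orthonormal_frame B" "?S \<subseteq> B"
    using orthonormal_frame_extending_slice[OF w] .
  have finB: "finite B" using B by (simp add: orthonormal_frame_def)
  have wB: "w \<in> B" using B by auto
  define pr where "pr y = para_proj p y + (y \<bullet> w) *\<^sub>R w" for y
  have lin: "linear pr"
    by (rule linearI) (simp_all add: pr_def linear_add[OF linear_para_proj] linear_scale[OF linear_para_proj] 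
        inner_add_left algebra_simps)
  have contpr: "continuous_on A pr" for A unfolding pr_def by (intro continuous_intros)
  have pr_slice: "pr y \<in> slice_space p w" for y
    using para_proj_in_para by (auto simp: pr_def slice_space_def)
  have pr_fix: "pr y = y" if "y \<in> slice_space p w" for y
    using that w by (auto simp: pr_def slice_space_def linear_add[OF linear_para_proj] linear_scale[OF linear_para_proj]
        para_proj_para para_proj_sphere inner_add_left para_inner_sphere sphere_inner_self)
  have para_slice: "x \<in> slice_space p w" if "x \<in> oct_para p" for x
    using that unfolding slice_space_def by (intro CollectI exI[of _ x] exI[of _ "0::real"]) simp
  define U where "U = pr -` \<Omega>"
  have prU: "y \<in> U \<longleftrightarrow> pr y \<in> slice_of p \<Omega> w" for y
    using pr_slice by (simp add: U_def slice_of_def)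
  have pr_S: "pr (y + t *\<^sub>R b) = pr y + t *\<^sub>R b" if b: "b \<in> ?S" for y t b
  proof -
    have "pr b = b" 
    proof (cases "b = w")
      case True then show ?thesis using w by (simp add: pr_def para_proj_sphere sphere_inner_self)
    next
      case False
      then obtain i where i: "b = oct_e i" "i \<le> p" using b by auto
      then have "b \<in> oct_para p" using oct_e_in_para by blast
      then show ?thesis using pr_fix para_slice by blast
    qed
    then show ?thesis by (simp add: linear_add[OF lin] linear_scale[OF lin])
  qed
  have pr_out: "pr (y + t *\<^sub>R b) = pr y" if b: "b \<in> B - ?S" for y t b
  proof -
    have "b \<bullet> v = 0" if "v \<in> ?S" for v
    proof -
      have "v \<in> B" "b \<noteq> v" "b \<in> B" using B(2) b that by blast+
      then show ?thesis using orthonormal_frame_inner[OF B(1), of b v] by simp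
    qed
    then have "b \<bullet> w = 0" "\<And>i. i \<in> {0..p} \<Longrightarrow> b \<bullet> oct_e i = 0" by blast+
    then have "pr b = 0" by (simp add: pr_def para_proj_def)
    then show ?thesis by (simp add: linear_add[OF lin] linear_scale[OF lin])
  qed
  define h where "h y = F (pr y)" for y
  define d where "d b y = (if b \<in> ?S then D b (pr y) else 0)" for b y
  have "monogenic_in_frame B U h d"
    unfolding monogenic_in_frame_def
  proof (intro conjI ballI)
    fix b y assume b: "b \<in> B" and y: "y \<in> U"
    show "((\<lambda>t. h (y + t *\<^sub>R b)) has_vector_derivative d b y) (at 0)"
    proof (cases "b \<in> ?S")
      case True
      then show ?thesis
        using derF[OF True, of "pr y"] y unfolding h_def d_def pr_S[OF True] by (simp add: prU)
    next
      case False
      then have "pr (y + t *\<^sub>R b) = pr y" for t using pr_out b by blast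
      then show ?thesis using False unfolding h_def d_def by simp
    qed
  next
    fix b assume "b \<in> B"
    show "continuous_on U (d b)"
    proof (cases "b \<in> ?S")
      case True
      have "continuous_on U (\<lambda>y. D b (pr y))"
        by (rule continuous_on_compose2[OF contD[OF True] contpr]) (auto simp: prU)
      then show ?thesis using True unfolding d_def by simp
    next
      case False
      then show ?thesis unfolding d_def by simp
    qed
  next
    fix y assume y: "y \<in> U"
    have "(\<Sum>b\<in>B. b \<odot> d b y) = (\<Sum>b\<in>?S. b \<odot> d b y)"
      using finB B(2) by (rule sum.mono_neutral_right) (simp add: d_def oct_mult.zero_right)
    also have "\<dots> = (\<Sum>b\<in>?S. b \<odot> D b (pr y))"
      by (rule sum.cong) (simp_all only: d_def if_True)
    also have "\<dots> = w \<odot> D w (pr y) + (\<Sum>b\<in>oct_e ` {0..p}. b \<odot> D b (pr y))"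
    proof -
      have "w \<notin> oct_e ` {0..p}"
        using w sphere_inner_self sphere_inner_oct_e by force
      then show ?thesis by simp
    qed
    also have "(\<Sum>b\<in>oct_e ` {0..p}. b \<odot> D b (pr y)) = (\<Sum>i=0..p. oct_e i \<odot> D (oct_e i) (pr y))"
      using p by (intro sum.reindex_cong[of oct_e]) (auto simp: inj_on_def oct_e_eq_iff)
    finally show "(\<Sum>b\<in>B. b \<odot> d b y) = 0" using eq[of "pr y"] y by (simp add: prU add.commute)
  qed
  moreover have "open U" unfolding U_def by (rule open_vimage[OF \<Omega> contpr])
  moreover have "connected U"
  proof -
    \<comment> \<open>\<open>U\<close> is the slice times the orthogonal complement of the slice space.\<close>
    have "U = (\<lambda>(z, y). z + (y - pr y)) ` (slice_of p \<Omega> w \<times> UNIV)"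
    proof (intro equalityI subsetI)
      fix y assume "y \<in> U"
      then show "y \<in> (\<lambda>(z, y). z + (y - pr y)) ` (slice_of p \<Omega> w \<times> UNIV)"
        by (intro image_eqI[of _ _ "(pr y, y)"]) (simp_all add: prU)
    next
      fix u assume "u \<in> (\<lambda>(z, y). z + (y - pr y)) ` (slice_of p \<Omega> w \<times> UNIV)"
      then obtain z y where u: "u = z + (y - pr y)" "z \<in> slice_of p \<Omega> w" by auto
      then have "pr u = z"
        using pr_fix[OF pr_slice, of y] pr_fix[of z] by (simp add: linear_add[OF lin] linear_diff[OF lin] slice_of_def)
      then show "u \<in> U" using u by (simp add: prU)
    qed
    moreover have "connected \<dots>"
      unfolding split_beta
      by (intro connected_continuous_image connected_Times conn connected_UNIV continuous_intros
           continuous_on_compose2[OF contpr[of UNIV]]) auto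
    ultimately show ?thesis by simp
  qed
  moreover have h0: "h y = 0" if "y \<in> U" "y \<bullet> w = 0" for y
    using that zero[of "pr y"] para_proj_in_para[of p y] unfolding h_def U_def by (auto simp: pr_def)
  moreover obtain a where a: "a \<in> \<Omega>" "a \<in> oct_para p" using ne by auto
  have a': "a \<in> U" "a \<bullet> w = 0"
    using a pr_fix[OF para_slice] para_inner_sphere[OF a(2) w] by (auto simp: U_def)
  have pz: "pr z = z" using z pr_fix by (simp add: slice_of_def)
  then have "z \<in> U" using z by (simp add: prU)
  ultimately have "h z = 0"
    using monogenic_zero_on_hyperplane[of B w U h d, OF B(1) wB _ _ _ h0 a'] by blast
  then show ?thesis using pz by (simp add: h_def)
qed

end

section \<open>The representation formula\<close>

lemma sphere_imaginary: "p \<le> 6 \<Longrightarrow> w \<in> oct_sphere p \<Longrightarrow> w $ 0 = 0"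
  using sphere_inner_oct_e[of p w 0] by (simp add: oct_e_def inner_axis)

lemma sphere_mult_self:
  assumes "p \<le> 6" "w \<in> oct_sphere p"
  shows "w \<odot> (w \<odot> a) = - a"
  using oct_imag_anticommute[of w w a] sphere_imaginary[OF assms] sphere_inner_self[OF assms]
  by (simp add: scaleR_2[symmetric] flip: scaleR_minus_right)

text \<open>
  For \<open>i \<ge> 1\<close> the unit \<open>e\<^sub>i\<close> anticommutes, as a left multiplication, with each of \<open>w\<close> and \<open>v\<close>, and
  the two signs cancel.
\<close>

lemma oct_e_commutes_sphere_pair:
  assumes p: "p \<le> 6" and w: "w \<in> oct_sphere p" and v: "v \<in> oct_sphere p" and i: "i \<le> p"
  shows "oct_e i \<odot> (w \<odot> (v \<odot> a)) = w \<odot> (v \<odot> (oct_e i \<odot> a))"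
proof (cases "i = 0")
  case False
  have im: "oct_e i $ 0 = 0"
    using oct_e_inner[of i 0] False i p by (simp add: oct_e_def inner_axis)
  have anti: "oct_e i \<odot> (u \<odot> a) = - (u \<odot> (oct_e i \<odot> a))" if "u \<in> oct_sphere p" for u a
    using oct_imag_anticommute[OF im sphere_imaginary[OF p that], of a] sphere_inner_oct_e[OF p that i]
    by (simp add: inner_commute add_eq_0_iff)
  show ?thesis by (simp add: anti[OF w] anti[OF v] oct_mult.minus_right)
qed simp

lemma has_partial_vector_derivative:
  "has_partial v f x \<Longrightarrow> ((\<lambda>t. f (x + t *\<^sub>R v)) has_vector_derivative partial v f x) (at 0)"
  by (simp add: has_partial_def partial_def vector_derivative_works)

text \<open>
  The pointwise computation behind the representation formula. Here \<open>a i\<close>, \<open>c\<close> and \<open>a' i\<close>, \<open>c'\<close> are the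
  partial derivatives of \<open>f\<close> on the slice through \<open>v\<close> at \<open>x + rv\<close> and \<open>x - rv\<close>, and \<open>b i\<close>, \<open>k\<close> those on the
  slice through \<open>w\<close> at \<open>x + rw\<close>. The derivative \<open>c'\<close> enters with a minus sign since \<open>x - rv\<close> moves against
  \<open>v\<close> as \<open>r\<close> grows.
\<close>

lemma splitting_remainder_monogenic:
  assumes p: "p \<le> 6" and w: "w \<in> oct_sphere p" and v: "v \<in> oct_sphere p"
    and up: "(\<Sum>i=0..p. oct_e i \<odot> a i) + v \<odot> c = 0"
    and down: "(\<Sum>i=0..p. oct_e i \<odot> a' i) + v \<odot> c' = 0"
    and here: "(\<Sum>i=0..p. oct_e i \<odot> b i) + w \<odot> k = 0"
  shows "(\<Sum>i=0..p. oct_e i \<odot> (b i - (1/2) *\<^sub>R (a i + a' i) - (1/2) *\<^sub>R (w \<odot> (v \<odot> (a' i - a i))))) +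
    w \<odot> (k - (1/2) *\<^sub>R (c - c') - (1/2) *\<^sub>R (w \<odot> (v \<odot> (- c' - c)))) = 0"
proof -
  define A where "A = (\<Sum>i=0..p. oct_e i \<odot> a i)"
  define A' where "A' = (\<Sum>i=0..p. oct_e i \<odot> a' i)"
  have A: "A = - (v \<odot> c)" and A': "A' = - (v \<odot> c')"
    using up down by (simp_all add: A_def A'_def add_eq_0_iff2)
  have "(\<Sum>i=0..p. oct_e i \<odot> (b i - (1/2) *\<^sub>R (a i + a' i) - (1/2) *\<^sub>R (w \<odot> (v \<odot> (a' i - a i)))))
    = (\<Sum>i=0..p. oct_e i \<odot> b i) - (1/2) *\<^sub>R (A + A') - (1/2) *\<^sub>R (\<Sum>i=0..p. oct_e i \<odot> (w \<odot> (v \<odot> (a' i - a i))))"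
    by (simp add: A_def A'_def oct_mult.diff_right oct_mult.add_right oct_mult.scaleR_right sum_subtractf sum.distrib
        scaleR_sum_right scaleR_right_distrib scaleR_right_diff_distrib)
  also have "(\<Sum>i=0..p. oct_e i \<odot> (w \<odot> (v \<odot> (a' i - a i)))) = (\<Sum>i=0..p. w \<odot> (v \<odot> (oct_e i \<odot> (a' i - a i))))"
    by (rule sum.cong) (simp_all add: oct_e_commutes_sphere_pair[OF p w v])
  also have "\<dots> = w \<odot> (v \<odot> (A' - A))"
    by (simp add: A_def A'_def oct_mult.diff_right oct_mult.sum_right sum_subtractf)
  also have "v \<odot> (A' - A) = c' - c"
    by (simp add: A A' oct_mult.diff_right oct_mult.minus_right sphere_mult_self[OF p v])
  also have "(\<Sum>i=0..p. oct_e i \<odot> b i) = - (w \<odot> k)"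
    using here by (simp add: add_eq_0_iff2)
  finally show ?thesis
    by (simp add: A A' oct_mult.diff_right oct_mult.add_right oct_mult.minus_right oct_mult.scaleR_right 
        sphere_mult_self[OF p w] scaleR_right_diff_distrib scaleR_right_distrib)
qed

lemma slice_mem:
  "x \<in> oct_para p \<Longrightarrow> x + r *\<^sub>R w \<in> \<Omega> \<Longrightarrow> x + r *\<^sub>R w \<in> slice_of p \<Omega> w"
  by (auto simp: slice_of_def slice_space_def)

text \<open>
  The difference \<open>F\<close> of the two sides, as a function on the slice through \<open>w\<close>, is monogenic there by the previous
  computation and vanishes on \<open>oct_para p\<close>, so it vanishes on the slice.
\<close>

lemma slice_representation:
  assumes p: "p \<le> 6" and dom: "slice_domain p \<Omega>" and sym: "p_symmetric p \<Omega>"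
    and f: "gen_partial_slice_monogenic p \<Omega> f"
    and w: "w \<in> oct_sphere p" and v: "v \<in> oct_sphere p" and x: "x \<in> oct_para p" and mem: "x + r *\<^sub>R w \<in> \<Omega>"
  shows "f (x + r *\<^sub>R w) = (1/2) *\<^sub>R (f (x + r *\<^sub>R v) + f (x - r *\<^sub>R v)) +
          (1/2) *\<^sub>R (w \<odot> (v \<odot> (f (x - r *\<^sub>R v) - f (x + r *\<^sub>R v))))"
proof -
  let ?T = "slice_of p \<Omega>"
  have der: "((\<lambda>t. f (z + t *\<^sub>R b)) has_vector_derivative partial b f z) (at 0)"
    and cont: "continuous_on (?T u) (partial b f)"
    and mono: "(\<Sum>i=0..p. oct_e i \<odot> partial (oct_e i) f z) + u \<odot> partial u f z = 0"
    if "u \<in> oct_sphere p" "z \<in> ?T u" "b \<in> insert u (oct_e ` {0..p})" for u z b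
    using f that by (auto simp: gen_partial_slice_monogenic_def slice_C1_def slice_D_def intro!: has_partial_vector_derivative)
  \<comment> \<open>The companions \<open>x \<plusminus> r v\<close> of the point \<open>z = x + r w\<close>.\<close>
  define up where "up z = para_proj p z + (z \<bullet> w) *\<^sub>R v" for z
  define down where "down z = para_proj p z - (z \<bullet> w) *\<^sub>R v" for z
  have split: "z = para_proj p z + (z \<bullet> w) *\<^sub>R w" if "z \<in> ?T w" for z
    using that w p
    by (auto simp: slice_of_def slice_space_def linear_add[OF linear_para_proj] linear_scale[OF linear_para_proj]
        para_proj_para para_proj_sphere inner_add_left para_inner_sphere sphere_inner_self)
  have up_mem: "up z \<in> ?T v" and down_mem: "down z \<in> ?T v" if z: "z \<in> ?T w" for z
  proof -
    have "para_proj p z + (z \<bullet> w) *\<^sub>R w \<in> \<Omega>"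
      using split[OF z] z by (simp add: slice_of_def)
    note sym_mem = p_symmetric_signed[OF p sym para_proj_in_para w _ this]
    show "up z \<in> ?T v"
      unfolding up_def by (rule slice_mem[OF para_proj_in_para sym_mem[OF v]])
    have "para_proj p z + (- (z \<bullet> w)) *\<^sub>R v \<in> \<Omega>"
      using sym_mem[OF sphere_uminus[OF p v]] by simp
    from slice_mem[OF para_proj_in_para this] show "down z \<in> ?T v"
      by (simp add: down_def)
  qed
  have up_e: "up (z + t *\<^sub>R oct_e i) = up z + t *\<^sub>R oct_e i" "down (z + t *\<^sub>R oct_e i) = down z + t *\<^sub>R oct_e i"
    if "i \<le> p" for z t i
  proof -
    have "oct_e i \<bullet> w = 0" using sphere_inner_oct_e[OF p w that] by (simp add: inner_commute)
    then show "up (z + t *\<^sub>R oct_e i) = up z + t *\<^sub>R oct_e i" "down (z + t *\<^sub>R oct_e i) = down z + t *\<^sub>R oct_e i"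
      using para_proj_para[OF p oct_e_in_para[OF p that]]
      by (simp_all add: up_def down_def linear_add[OF linear_para_proj] linear_scale[OF linear_para_proj] inner_add_left)
  qed
  have up_w: "up (z + t *\<^sub>R w) = up z + t *\<^sub>R v" "down (z + t *\<^sub>R w) = down z + (- t) *\<^sub>R v" for z t
    using para_proj_sphere[OF p w] sphere_inner_self[OF p w]
    by (simp_all add: up_def down_def linear_add[OF linear_para_proj] linear_scale[OF linear_para_proj] inner_add_left algebra_simps)
  have cont_ud: "continuous_on A up" "continuous_on A down" for A
    unfolding up_def down_def by (intro continuous_intros)+
  define F where "F z = f z - (1/2) *\<^sub>R (f (up z) + f (down z)) - (1/2) *\<^sub>R (w \<odot> (v \<odot> (f (down z) - f (up z))))" for z
  \<comment> \<open>The same linear combination \<open>G\<close> governs the values and the derivatives of \<open>F\<close>.\<close>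
  define G where "G b k k' = b - (1/2) *\<^sub>R (k + k') - (1/2) *\<^sub>R (w \<odot> (v \<odot> (k' - k)))" for b k k' :: octonion
  define D where "D b z = (if b = w then G (partial w f z) (partial v f (up z)) (- partial v f (down z))
      else G (partial b f z) (partial b f (up z)) (partial b f (down z)))" for b z
  have F_G: "F = (\<lambda>z. G (f z) (f (up z)) (f (down z)))" by (simp add: fun_eq_iff F_def G_def)
  have derG: "((\<lambda>t. G (g1 t) (g2 t) (g3 t)) has_vector_derivative G d1 d2 d3) (at 0)"
    if "(g1 has_vector_derivative d1) (at 0)" "(g2 has_vector_derivative d2) (at 0)" "(g3 has_vector_derivative d3) (at 0)"
    for g1 g2 g3 d1 d2 d3
    unfolding G_def
    by (intro derivative_intros that bounded_linear.has_vector_derivative[OF oct_mult.bounded_linear_right]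
        bounded_linear.has_vector_derivative[OF bounded_linear_scaleR_right])
  have contG: "continuous_on A (\<lambda>z. G (g1 z) (g2 z) (g3 z))"
    if "continuous_on A g1" "continuous_on A g2" "continuous_on A g3" for A :: "octonion set" and g1 g2 g3
    unfolding G_def by (intro continuous_intros that)
  have e_ne_w: "oct_e i \<noteq> w" if "i \<le> p" for i
    using sphere_inner_oct_e[OF p w that] sphere_inner_self[OF p w] by auto
  have "F (x + r *\<^sub>R w) = 0"
  proof (rule slice_monogenic_zero_on_para[OF p w, where F = F and D = D and \<Omega> = \<Omega>])
    show "open \<Omega>" "connected (?T w)" "\<Omega> \<inter> oct_para p \<noteq> {}"
      using dom w by (auto simp: slice_domain_def)
    show "x + r *\<^sub>R w \<in> ?T w" using x mem by (rule slice_mem)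
    show "F y = 0" if "y \<in> \<Omega> \<inter> oct_para p" for y
    proof -
      have "up y = y" "down y = y"
        using that w p by (simp_all add: up_def down_def para_proj_para para_inner_sphere)
      then show ?thesis by (simp add: F_def oct_mult.zero_right flip: scaleR_left_distrib scaleR_2)
    qed
    show "((\<lambda>t. F (z + t *\<^sub>R b)) has_vector_derivative D b z) (at 0)"
      if b: "b \<in> insert w (oct_e ` {0..p})" and z: "z \<in> ?T w" for b z
    proof (cases "b = w")
      case True
      have "((\<lambda>t. f (down z + t *\<^sub>R v)) has_vector_derivative partial v f (down z)) (at (- 0))"
        using der[OF v down_mem[OF z]] by simp
      then have "((\<lambda>t. f (down z + (- t) *\<^sub>R v)) has_vector_derivative - partial v f (down z)) (at 0)"
        using vector_diff_chain_at[of "\<lambda>t. - t" "-1" 0 "\<lambda>t. f (down z + t *\<^sub>R v)" "partial v f (down z)"]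
          has_vector_derivative_minus[OF has_vector_derivative_id] by (simp add: o_def)
      then show ?thesis
        unfolding F_G True D_def up_w using der[OF w z] der[OF v up_mem[OF z]] by (simp add: derG)
    next
      case False
      then obtain i where i: "b = oct_e i" "i \<le> p" using b by auto
      show ?thesis
        using False der[OF w z] der[OF v up_mem[OF z]] der[OF v down_mem[OF z]] i
        unfolding F_G D_def i(1) up_e[OF i(2)] by (simp add: derG)
    qed
    show "continuous_on (?T w) (D b)" if b: "b \<in> insert w (oct_e ` {0..p})" for b
    proof (cases "?T w = {}")
      case False
      then obtain z where z: "z \<in> ?T w" by auto
      have c: "continuous_on (?T w) (partial b f)" if "b \<in> insert w (oct_e ` {0..p})" for b
        using cont[OF w z that] .
      have cu: "continuous_on (?T w) (\<lambda>z. partial b f (up z))" "continuous_on (?T w) (\<lambda>z. partial b f (down z))"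
        if "b \<in> insert v (oct_e ` {0..p})" for b
        using cont[OF v up_mem[OF z] that] up_mem down_mem
        by (auto intro!: continuous_on_compose2[OF _ cont_ud(1)] continuous_on_compose2[OF _ cont_ud(2)])
      show ?thesis
      proof (cases "b = w")
        case True
        then show ?thesis unfolding D_def by (simp add: contG c cu continuous_on_minus)
      next
        case False
        then have "b \<in> insert v (oct_e ` {0..p})" using b by auto
        then show ?thesis using False unfolding D_def by (simp add: contG c[OF b] cu)
      qed
    qed simp
    show "(\<Sum>i=0..p. oct_e i \<odot> D (oct_e i) z) + w \<odot> D w z = 0" if z: "z \<in> ?T w" for z
    proof -
      have "(\<Sum>i=0..p. oct_e i \<odot> D (oct_e i) z) = (\<Sum>i=0..p. oct_e i \<odot>
          G (partial (oct_e i) f z) (partial (oct_e i) f (up z)) (partial (oct_e i) f (down z)))"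
        by (rule sum.cong) (simp_all add: D_def e_ne_w)
      then show ?thesis
        using splitting_remainder_monogenic[OF p w v mono[OF v up_mem[OF z] insertI1] mono[OF v down_mem[OF z] insertI1]
            mono[OF w z insertI1]]
        by (simp add: D_def G_def)
    qed
  qed
  moreover have "up (x + r *\<^sub>R w) = x + r *\<^sub>R v" "down (x + r *\<^sub>R w) = x - r *\<^sub>R v"
    using up_w[of x r] para_proj_para[OF p x] para_inner_sphere[OF p x w] by (simp_all add: up_def down_def)
  ultimately show ?thesis by (simp add: F_def algebra_simps)
qed

text \<open>
  The representation formula says that \<open>f(x + rs) = F\<^sub>1 + sF\<^sub>2\<close> for all \<open>s\<close> in the sphere, with
  \<open>F\<^sub>1\<close> and \<open>F\<^sub>2\<close> formed from one vector \<open>v\<close>. Taking \<open>s = u\<close> and \<open>s = -u\<close> recovers the same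
  \<open>F\<^sub>1\<close> and \<open>F\<^sub>2\<close> from \<open>u\<close>.
\<close>

theorem theorem3p16:
  fixes p :: nat and \<Omega> :: "octonion set" and f :: "octonion \<Rightarrow> octonion"
  assumes "p \<le> 6"
    and "slice_domain p \<Omega>"
    and "p_symmetric p \<Omega>"
    and "gen_partial_slice_monogenic p \<Omega> f"
  shows "(\<forall>\<omega> \<in> oct_sphere p. \<forall>x \<in> oct_para p. \<forall>r \<ge> 0. x + r *\<^sub>R \<omega> \<in> \<Omega> \<longrightarrow>
      (\<forall>\<eta> \<in> oct_sphere p.
        f (x + r *\<^sub>R \<omega>) =
          (1/2) *\<^sub>R (f (x + r *\<^sub>R \<eta>) + f (x - r *\<^sub>R \<eta>)) +
          (1/2) *\<^sub>R (\<omega> \<odot> (\<eta> \<odot> (f (x - r *\<^sub>R \<eta>) - f (x + r *\<^sub>R \<eta>)))))) \<and>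
    (\<forall>\<omega> \<in> oct_sphere p. \<forall>x \<in> oct_para p. \<forall>r \<ge> 0. x + r *\<^sub>R \<omega> \<in> \<Omega> \<longrightarrow>
      (\<forall>\<eta> \<in> oct_sphere p. \<forall>\<eta>' \<in> oct_sphere p.
        (1/2) *\<^sub>R (f (x + r *\<^sub>R \<eta>) + f (x - r *\<^sub>R \<eta>)) =
          (1/2) *\<^sub>R (f (x + r *\<^sub>R \<eta>') + f (x - r *\<^sub>R \<eta>')) \<and>
        (1/2) *\<^sub>R (\<eta> \<odot> (f (x - r *\<^sub>R \<eta>) - f (x + r *\<^sub>R \<eta>))) =
          (1/2) *\<^sub>R (\<eta>' \<odot> (f (x - r *\<^sub>R \<eta>') - f (x + r *\<^sub>R \<eta>')))))"
proof (intro conjI ballI allI impI)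
  note repr = slice_representation[OF assms]
  fix w x r v assume "w \<in> oct_sphere p" "x \<in> oct_para p" "x + r *\<^sub>R w \<in> \<Omega>" "v \<in> oct_sphere p"
  then show "f (x + r *\<^sub>R w) = (1/2) *\<^sub>R (f (x + r *\<^sub>R v) + f (x - r *\<^sub>R v)) +
          (1/2) *\<^sub>R (w \<odot> (v \<odot> (f (x - r *\<^sub>R v) - f (x + r *\<^sub>R v))))"
    by (intro repr)
next
  fix w x r u v assume w: "w \<in> oct_sphere p" and x: "x \<in> oct_para p" and mem: "x + r *\<^sub>R w \<in> \<Omega>"
    and u: "u \<in> oct_sphere p" and v: "v \<in> oct_sphere p"
  define F2 where "F2 = (1/2) *\<^sub>R (v \<odot> (f (x - r *\<^sub>R v) - f (x + r *\<^sub>R v)))"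
  define F1 where "F1 = (1/2) *\<^sub>R (f (x + r *\<^sub>R v) + f (x - r *\<^sub>R v))"
  have repr: "f (x + r *\<^sub>R s) = F1 + s \<odot> F2" if s: "s \<in> oct_sphere p" for s
    using slice_representation[OF assms s v x p_symmetric_signed[OF assms(1,3) x w s mem]]
    by (simp add: F1_def F2_def oct_mult.scaleR_right)
  have plus: "f (x + r *\<^sub>R u) = F1 + u \<odot> F2" by (rule repr[OF u])
  have minus: "f (x - r *\<^sub>R u) = F1 - u \<odot> F2"
    using repr[OF sphere_uminus[OF assms(1) u]] by (simp add: oct_mult.minus_left)
  show "(1/2) *\<^sub>R (f (x + r *\<^sub>R u) + f (x - r *\<^sub>R u)) = (1/2) *\<^sub>R (f (x + r *\<^sub>R v) + f (x - r *\<^sub>R v))"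
    unfolding plus minus F1_def[symmetric] by (simp flip: scaleR_2)
  have "f (x - r *\<^sub>R u) - f (x + r *\<^sub>R u) = (- 2) *\<^sub>R (u \<odot> F2)"
    unfolding plus minus by (simp add: scaleR_2)
  then have "u \<odot> (f (x - r *\<^sub>R u) - f (x + r *\<^sub>R u)) = 2 *\<^sub>R F2"
    by (simp only: oct_mult.scaleR_right sphere_mult_self[OF assms(1) u]) simp
  then show "(1/2) *\<^sub>R (u \<odot> (f (x - r *\<^sub>R u) - f (x + r *\<^sub>R u))) = (1/2) *\<^sub>R (v \<odot> (f (x - r *\<^sub>R v) - f (x + r *\<^sub>R v)))"
    unfolding F2_def[symmetric] by simp
qed

end
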